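(* Let $X$ be a subshift generated by a primitive and recognizable directive sequence $\boldsymbol\tau = (\tau_n \colon \mathcal A_{n+1}^* \to \mathcal A_n^* )_{n\geq0}$. Assume that $\boldsymbol\tau$ is decisive or that $(|\mathcal A_n| : n \geq 0)$ is bounded. Then, for every eigenvalue $\alpha$ of $X$ and every sufficiently large $n$, there exists an integer vector $(w_a)_{a\in\mathcal A_n} \in \mathbb Z^{\mathcal A_n}$ such that $$\alpha = \sum_{a\in\mathcal A_n} w_a\, \mu(B_n(a)) \qquad\text{for all } \mu \in \mathcal M(X,S).$$
   Context: Alphabets are finite sets with at least two elements. $\mathcal A^*$ is the free monoid of finite words over $\mathcal A$ and $|w|$ is the length of $w$. $S$ is the shift map $S((x_k)_k)=(x_{k+1})_k$ on $\mathcal A^{\mathbb Z}$; a subshift is a closed set $X\subseteq\mathcal A^{\mathbb Z}$ with $S(X)=X$; $\mathcal L(X)$ is the set of finite words occurring in points of $X$; $\mathcal M(X,S)$ is the set of $S$-invariant Borel probability measures on $X$. A substitution $\tau:\mathcal A^*\to\mathcal B^*$ is a monoid morphism such that $\tau(a)$ is non-empty for every $a\in\mathcal A$ and every $b\in\mathcal B$ occurs in some $\tau(a)$; it acts on $x\in\mathcal A^{\mathbb Z}$ by concatenation, with $\tau(x_0)$ starting at coordinate $0$. A directive sequence $\boldsymbol\tau=(\tau_n)_{n\ge0}$ consists of substitutions $\tau_n:\mathcal A_{n+1}^*\to\mathcal A_n^*$. Put $\tau_{n,m}=\tau_n\circ\cdots\circ\tau_{m-1}$ for $m>n$. $X^{(n)}_{\boldsymbol\tau}$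 is the set of $x\in\mathcal A_n^{\mathbb Z}$ such that every finite factor of $x$ occurs in $\tau_{n,m}(a)$ for some $m>n$ and $a\in\mathcal A_m$; $X_{\boldsymbol\tau}=X^{(0)}_{\boldsymbol\tau}$; $\boldsymbol\tau$ generates $X$ if $X=X_{\boldsymbol\tau}$. For $n\ge 1$ and $a\in\mathcal A_n$, $B_n(a)=\{\tau_{0,n}(x):x\in X^{(n)}_{\boldsymbol\tau},\ x_0=a\}$. $\boldsymbol\tau$ is primitive if for every $n$ there is $m>n$ such that every letter of $\mathcal A_n$ occurs in $\tau_{n,m}(a)$ for every $a\in\mathcal A_m$. It is recognizable if, for every $n\ge1$, the sets $S^kB_n(a)$ ($a\in\mathcal A_n$, $0\le k<|\tau_{0,n}(a)|$) are pairwise disjoint. It is everywhere growing if $\min_{a\in\mathcal A_n}|\tau_{0,n}(a)|\to\infty$ as $n\to\infty$. An everywhere growing $\boldsymbol\tau$ is decisive if for every $n\ge0$ there exist maps $\ell,r:\mathcal A_{n+1}\to\mathcal A_n$ such that, for all letters $a,b$ with $ab\in\mathcal L(X^{(n+1)}_{\boldsymbol\tau})$, the word $\tau_n(b)$ begins with $r(a)$ and $\tau_n(a)$ ends with $\ell(b)$. A real number $\alpha$ is an eigenvalue (meaning continuous additive eigenvalue) of $X$ if there is a continuous $g:X\to\mathbb R/\mathbb Z$ with $g(Sx)=g(x)+\alpha \pmod{\mathbb Z}$ for all $x\in X$. *)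

theory Defs
  imports "HOL-Probability.Probability_Measure" "HOL-Library.Sublist"
begin

section \<open>Subshifts\<close>

definition alphabet :: "'a set \<Rightarrow> bool" where
  "alphabet A \<longleftrightarrow> finite A \<and> 2 \<le> card A"

definition full_shift :: "'a set \<Rightarrow> (int \<Rightarrow> 'a) topology" where
  "full_shift A = product_topology (\<lambda>_. discrete_topology A) UNIV"

definition shift :: "(int \<Rightarrow> 'a) \<Rightarrow> int \<Rightarrow> 'a" where
  "shift x = (\<lambda>k. x (k + 1))"

definition subshift :: "'a set \<Rightarrow> (int \<Rightarrow> 'a) set \<Rightarrow> bool" where
  "subshift A X \<longleftrightarrow> closedin (full_shift A) X \<and> shift ` X = X"

definition factor :: "(int \<Rightarrow> 'a) \<Rightarrow> int \<Rightarrow> nat \<Rightarrow> 'a list" where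
  "factor x i l = map (\<lambda>k. x (i + int k)) [0..<l]"

definition language :: "(int \<Rightarrow> 'a) set \<Rightarrow> 'a list set" where
  "language X = {factor x i l | x i l. x \<in> X}"

definition subshift_topology :: "'a set \<Rightarrow> (int \<Rightarrow> 'a) set \<Rightarrow> (int \<Rightarrow> 'a) topology" where
  "subshift_topology A X = subtopology (full_shift A) X"

definition borel_on :: "'b topology \<Rightarrow> 'b measure" where
  "borel_on T = sigma (topspace T) {U. openin T U}"

definition invariant_measures :: "'a set \<Rightarrow> (int \<Rightarrow> 'a) set \<Rightarrow> (int \<Rightarrow> 'a) measure set" where
  "invariant_measures A X =
     {\<mu>. prob_space \<mu> \<and> space \<mu> = X \<and> sets \<mu> = sets (borel_on (subshift_topology A X)) \<and>
         (\<forall>E\<in>sets \<mu>. emeasure \<mu> (shift -` E \<inter> space \<mu>) = emeasure \<mu> E)}"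


section \<open>Continuous additive eigenvalues\<close>

text \<open>The circle \<open>\<real>/\<int>\<close> is the set of cosets \<open>x + \<int>\<close> with the quotient topology.\<close>

definition int_cong :: "(real \<times> real) set" where
  "int_cong = {(x, y). y - x \<in> \<int>}"

definition circle_topology :: "real set topology" where
  "circle_topology =
     topology (\<lambda>U. U \<subseteq> UNIV // int_cong \<and> open {x. int_cong `` {x} \<in> U})"

lemma openin_circle_topology:
  "openin circle_topology U \<longleftrightarrow> U \<subseteq> UNIV // int_cong \<and> open {x. int_cong `` {x} \<in> U}"
proof -
  have "istopology (\<lambda>U. U \<subseteq> UNIV // int_cong \<and> open {x. int_cong `` {x} \<in> U})"
    unfolding istopology_def
  proof (intro conjI allI impI)
    fix S T
    assume "S \<subseteq> UNIV // int_cong \<and> open {x. int_cong `` {x} \<in> S}"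
      and "T \<subseteq> UNIV // int_cong \<and> open {x. int_cong `` {x} \<in> T}"
    then show "S \<inter> T \<subseteq> UNIV // int_cong" "open {x. int_cong `` {x} \<in> S \<inter> T}"
      by (auto simp: Collect_conj_eq)
  next
    fix K
    assume *: "\<forall>U\<in>K. U \<subseteq> UNIV // int_cong \<and> open {x. int_cong `` {x} \<in> U}"
    then show "\<Union>K \<subseteq> UNIV // int_cong"
      by blast
    have "{x. int_cong `` {x} \<in> \<Union>K} = (\<Union>U\<in>K. {x. int_cong `` {x} \<in> U})"
      by blast
    with * show "open {x. int_cong `` {x} \<in> \<Union>K}"
      by auto
  qed
  then show ?thesis
    by (simp add: circle_topology_def)
qed

lemma quotient_map_circle:
  "quotient_map euclidean circle_topology (\<lambda>x. int_cong `` {x})"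
proof -
  have "topspace circle_topology = UNIV // int_cong"
  proof (rule antisym)
    show "topspace circle_topology \<subseteq> UNIV // int_cong"
      using openin_topspace[of circle_topology] unfolding openin_circle_topology by (rule conjunct1)
    have "{x. int_cong `` {x} \<in> UNIV // int_cong} = UNIV"
      by (auto intro: quotientI)
    then have "openin circle_topology (UNIV // int_cong)"
      by (simp add: openin_circle_topology)
    then show "UNIV // int_cong \<subseteq> topspace circle_topology"
      by (rule openin_subset)
  qed
  then show ?thesis
    by (auto simp: quotient_map_def openin_circle_topology quotient_def)
qed

text \<open>For a coset \<open>c\<close>, the image of \<open>c\<close> under translation by \<open>\<alpha>\<close> is \<open>c + \<alpha>\<close> in \<open>\<real>/\<int>\<close>.\<close>

definition eigenvalue :: "'a set \<Rightarrow> (int \<Rightarrow> 'a) set \<Rightarrow> real \<Rightarrow> bool" where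
  "eigenvalue A X \<alpha> \<longleftrightarrow>
     (\<exists>g. continuous_map (subshift_topology A X) circle_topology g \<and>
          (\<forall>x\<in>X. g (shift x) = (\<lambda>y. y + \<alpha>) ` g x))"


section \<open>Substitutions\<close>

text \<open>A morphism \<open>\<A>\<^sup>* \<rightarrow> \<B>\<^sup>*\<close> is a function on all lists of which only the values on
  \<open>lists A\<close> matter.\<close>

definition substitution :: "'a set \<Rightarrow> 'b set \<Rightarrow> ('a list \<Rightarrow> 'b list) \<Rightarrow> bool" where
  "substitution A B t \<longleftrightarrow>
     t \<in> lists A \<rightarrow> lists B \<and>
     t [] = [] \<and> (\<forall>u\<in>lists A. \<forall>v\<in>lists A. t (u @ v) = t u @ t v) \<and>
     (\<forall>a\<in>A. t [a] \<noteq> []) \<and>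
     (\<forall>b\<in>B. \<exists>a\<in>A. b \<in> set (t [a]))"

text \<open>Since \<open>t\<close> is non-erasing, \<open>t (x\<^sub>0 \<dots> x\<^sub>i)\<close> has a letter number \<open>i\<close> for \<open>i \<ge> 0\<close>, and
  \<open>t (x\<^sub>i \<dots> x\<^sub>-\<^sub>1)\<close> has a letter number \<open>-i\<close> counted from the right for \<open>i < 0\<close>.\<close>

definition apply_point :: "('a list \<Rightarrow> 'b list) \<Rightarrow> (int \<Rightarrow> 'a) \<Rightarrow> int \<Rightarrow> 'b" where
  "apply_point t x i =
     (if 0 \<le> i then t (map x [0..i]) ! nat i
      else rev (t (map x [i..-1])) ! nat (- i - 1))"

lemma length_substitution_ge:
  assumes "substitution A B t" "u \<in> lists A"
  shows "length u \<le> length (t u)"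
  using assms(2)
proof (induction u)
  case (Cons a u)
  then have "t (a # u) = t [a] @ t u" "t [a] \<noteq> []"
    using assms(1) unfolding substitution_def by (metis append_Cons append_Nil lists.simps, auto)
  with Cons show ?case
    by (cases "t [a]") auto
qed simp

lemma apply_point_right:
  assumes t: "substitution A B t" and x: "\<And>i. x i \<in> A" and k: "k < length (t (map x [0..j]))"
  shows "apply_point t x (int k) = t (map x [0..j]) ! k"
proof -
  have app: "t (map x [0..n]) = t (map x [0..m]) @ t (map x [m+1..n])"
    if "-1 \<le> m" "m \<le> n" for m n
  proof -
    have "[0..n] = [0..m] @ [m+1..n]"
      using that by (cases "m = -1") (auto intro: upto_split2)
    moreover have "map x [0..m] \<in> lists A" "map x [m+1..n] \<in> lists A"
      using x by auto
    ultimately show ?thesis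
      using t by (simp add: substitution_def)
  qed
  have "map x [0..int k] \<in> lists A"
    using x by auto
  from length_substitution_ge[OF t this] have len: "k < length (t (map x [0..int k]))"
    by simp
  have "j \<ge> -1"
  proof (rule ccontr)
    assume "\<not> j \<ge> -1"
    then show False using k t by (simp add: substitution_def)
  qed
  have "t (map x [0..int k]) ! k = t (map x [0..j]) ! k"
  proof (cases "j \<le> int k")
    case True
    show ?thesis
      unfolding app[OF \<open>j \<ge> -1\<close> True] using k by (rule nth_append_left)
  next
    case False
    then have "-1 \<le> int k" "int k \<le> j"
      by auto
    from app[OF this] show ?thesis
      using len by (simp only: nth_append_left)
  qed
  then show ?thesis
    by (simp add: apply_point_def)
qed

lemma apply_point_left:
  assumes t: "substitution A B t" and x: "\<And>i. x i \<in> A" and k: "k < length (t (map x [j..-1]))"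
  shows "apply_point t x (- int k - 1) = rev (t (map x [j..-1])) ! k"
proof -
  have app: "t (map x [n..-1]) = t (map x [n..m-1]) @ t (map x [m..-1])"
    if "m \<le> 0" "n \<le> m" for m n
  proof -
    have "[n..-1] = [n..m-1] @ [m..-1]"
      using that by (cases "m = 0") (auto intro: upto_split1)
    moreover have "map x [n..m-1] \<in> lists A" "map x [m..-1] \<in> lists A"
      using x by auto
    ultimately show ?thesis
      using t by (simp add: substitution_def)
  qed
  have "map x [- int k - 1..-1] \<in> lists A"
    using x by auto
  from length_substitution_ge[OF t this] have len: "k < length (t (map x [- int k - 1..-1]))"
    by simp
  have "j \<le> 0"
  proof (rule ccontr)
    assume "\<not> j \<le> 0"
    then show False using k t by (simp add: substitution_def)
  qed
  have "rev (t (map x [- int k - 1..-1])) ! k = rev (t (map x [j..-1])) ! k"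
  proof (cases "- int k - 1 \<le> j")
    case True
    show ?thesis
      unfolding app[OF \<open>j \<le> 0\<close> True] rev_append
      using k by (intro nth_append_left) simp
  next
    case False
    then have "- int k - 1 \<le> 0" "j \<le> - int k - 1"
      by auto
    from app[OF this] show ?thesis
      using len by (simp only: rev_append nth_append_left length_rev)
  qed
  then show ?thesis
    by (simp add: apply_point_def)
qed


section \<open>Directive sequences\<close>

text \<open>All alphabets of a directive sequence live in one type; they are the sets \<open>A n\<close>.\<close>

definition directive_sequence :: "(nat \<Rightarrow> 'a set) \<Rightarrow> (nat \<Rightarrow> 'a list \<Rightarrow> 'a list) \<Rightarrow> bool" where
  "directive_sequence A \<tau> \<longleftrightarrow>
     (\<forall>n. alphabet (A n) \<and> substitution (A (Suc n)) (A n) (\<tau> n))"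

definition compose :: "(nat \<Rightarrow> 'a list \<Rightarrow> 'a list) \<Rightarrow> nat \<Rightarrow> nat \<Rightarrow> 'a list \<Rightarrow> 'a list" where
  "compose \<tau> n m = foldr (\<circ>) (map \<tau> [n..<m]) id"

definition level_shift ::
  "(nat \<Rightarrow> 'a set) \<Rightarrow> (nat \<Rightarrow> 'a list \<Rightarrow> 'a list) \<Rightarrow> nat \<Rightarrow> (int \<Rightarrow> 'a) set" where
  "level_shift A \<tau> n =
     {x \<in> topspace (full_shift (A n)).
        \<forall>i l. \<exists>m>n. \<exists>a\<in>A m. sublist (factor x i l) (compose \<tau> n m [a])}"

definition generates ::
  "(nat \<Rightarrow> 'a set) \<Rightarrow> (nat \<Rightarrow> 'a list \<Rightarrow> 'a list) \<Rightarrow> (int \<Rightarrow> 'a) set \<Rightarrow> bool" where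
  "generates A \<tau> X \<longleftrightarrow> X = level_shift A \<tau> 0"

definition base ::
  "(nat \<Rightarrow> 'a set) \<Rightarrow> (nat \<Rightarrow> 'a list \<Rightarrow> 'a list) \<Rightarrow> nat \<Rightarrow> 'a \<Rightarrow> (int \<Rightarrow> 'a) set" where
  "base A \<tau> n a = {apply_point (compose \<tau> 0 n) x | x. x \<in> level_shift A \<tau> n \<and> x 0 = a}"

definition primitive :: "(nat \<Rightarrow> 'a set) \<Rightarrow> (nat \<Rightarrow> 'a list \<Rightarrow> 'a list) \<Rightarrow> bool" where
  "primitive A \<tau> \<longleftrightarrow> (\<forall>n. \<exists>m>n. \<forall>a\<in>A m. \<forall>b\<in>A n. b \<in> set (compose \<tau> n m [a]))"

definition recognizable :: "(nat \<Rightarrow> 'a set) \<Rightarrow> (nat \<Rightarrow> 'a list \<Rightarrow> 'a list) \<Rightarrow> bool" where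
  "recognizable A \<tau> \<longleftrightarrow>
     (\<forall>n\<ge>1. disjoint_family_on (\<lambda>(a, k). (shift ^^ k) ` base A \<tau> n a)
              (SIGMA a:A n. {..<length (compose \<tau> 0 n [a])}))"

definition everywhere_growing :: "(nat \<Rightarrow> 'a set) \<Rightarrow> (nat \<Rightarrow> 'a list \<Rightarrow> 'a list) \<Rightarrow> bool" where
  "everywhere_growing A \<tau> \<longleftrightarrow>
     filterlim (\<lambda>n. Min ((\<lambda>a. length (compose \<tau> 0 n [a])) ` A n)) at_top sequentially"

definition decisive :: "(nat \<Rightarrow> 'a set) \<Rightarrow> (nat \<Rightarrow> 'a list \<Rightarrow> 'a list) \<Rightarrow> bool" where
  "decisive A \<tau> \<longleftrightarrow> everywhere_growing A \<tau> \<and>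
     (\<forall>n. \<exists>l\<in>A (Suc n) \<rightarrow> A n. \<exists>r\<in>A (Suc n) \<rightarrow> A n.
        \<forall>a\<in>A (Suc n). \<forall>b\<in>A (Suc n). [a, b] \<in> language (level_shift A \<tau> (Suc n)) \<longrightarrow>
          prefix [r a] (\<tau> n [b]) \<and> suffix [l b] (\<tau> n [a]))"

end

theory Submission
  imports Defs
begin

text \<open>
  Let \<open>E = exp (2 \<pi> i g)\<close> for a continuous eigenfunction \<open>g\<close>, so that \<open>E\<close> has modulus \<open>1\<close> and
  the shift multiplies it by \<open>exp (2 \<pi> i \<alpha>)\<close>.  By uniform continuity \<open>E x\<close> is determined up to
  \<open>\<epsilon>\<close> by a finite window of \<open>x\<close>, and moving that window to the right of the origin merely rotates
  the value; hence it is determined up to \<open>\<epsilon>\<close> by a finite prefix of \<open>x\<close> at coordinates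
  \<open>0, 1, \<dots>\<close> (\<open>character_one_sided\<close>).  Primitivity makes the words \<open>\<tau>\<^sub>0\<^sub>,\<^sub>n(a)\<close> long, and all
  points of \<open>B\<^sub>n(a)\<close> begin with this word, so \<open>E\<close> is almost constant on \<open>B\<^sub>n(a)\<close>, even though
  the levels of the towers over \<open>B\<^sub>n(a)\<close> need not have small diameter.

  Recognizability and a compactness argument (\<open>level_shift_covered\<close>) show that the sets
  \<open>S\<^sup>k B\<^sub>n(a)\<close> partition \<open>X\<close>.  This allows a real lift \<open>G\<close> of the eigenfunction to be defined
  tower by tower: an angle near the values of \<open>E\<close> on the base, increased by \<open>\<alpha>\<close> from one level to
  the next.  Then \<open>F = G + \<alpha> - G \<circ> S\<close> is integer valued with integral \<open>\<alpha>\<close> for every invariant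
  measure, and it vanishes except on the top levels, where a point over \<open>a\<close> passes to the base over
  the letter \<open>b\<close> that comes next.  If \<open>F\<close> is constant on each top level, its values are the
  wanted \<open>w\<^sub>a\<close>, because all levels over \<open>a\<close> have the measure of \<open>B\<^sub>n(a)\<close>
  (\<open>integral_representation\<close>).

  The only obstacle is that the angle chosen over \<open>b\<close> may depend on which \<open>b\<close> follows \<open>a\<close>.  It is
  removed by using one angle for a whole class of letters, where all letters that can follow \<open>a\<close>
  are in the same class and \<open>E\<close> varies little over each class.  In the decisive case the class of
  \<open>b\<close> is the first letter of \<open>\<tau>\<^sub>n\<^sub>-\<^sub>1(b)\<close> (\<open>decisive_classes\<close>).  For bounded alphabets the classes
  are generated by declaring letters with a common predecessor equivalent; \<open>E\<close> nearly agrees on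
  two such letters because it nearly agrees on points over the predecessor, and a bounded number of
  such steps connects any two letters of a class (\<open>chain_close\<close>).
\<close>

section \<open>The topology of the full shift\<close>

lemma topspace_full_shift: "topspace (full_shift A) = {x. \<forall>i. x i \<in> A}"
  by (auto simp: full_shift_def PiE_def extensional_def Pi_def)

lemma compact_space_full_shift: "finite A \<Longrightarrow> compact_space (full_shift A)"
  by (simp add: full_shift_def compact_space_product_topology compact_space_discrete_topology)

lemma Hausdorff_space_full_shift: "Hausdorff_space (full_shift A)"
  by (simp add: full_shift_def Hausdorff_space_product_topology Hausdorff_space_discrete_topology)

text \<open>A condition on finitely many coordinates cuts out a union of cylinders.  Such conditions are
  the only source of open and closed sets below.\<close>

lemma openin_window:
  fixes N :: int
  assumes P: "\<And>x y. \<lbrakk>\<And>i. x i \<in> A; \<And>i. y i \<in> A; \<And>i. \<bar>i\<bar> \<le> N \<Longrightarrow> x i = y i; P x\<rbrakk> \<Longrightarrow> P y"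
  shows "openin (full_shift A) {x \<in> topspace (full_shift A). P x}"
  unfolding topspace_full_shift
  unfolding full_shift_def openin_product_topology_alt
proof
  fix x assume "x \<in> {x \<in> {x. \<forall>i. x i \<in> A}. P x}"
  then have x: "\<And>i. x i \<in> A" "P x" by auto
  define U where "U i = (if \<bar>i\<bar> \<le> N then {x i} else A)" for i
  have "finite {i \<in> UNIV. U i \<noteq> topspace (discrete_topology A)}"
    by (rule finite_subset[of _ "{-N..N}"]) (auto simp: U_def)
  moreover have "\<forall>i\<in>UNIV. openin (discrete_topology A) (U i)"
    using x by (auto simp: U_def)
  moreover have "x \<in> Pi\<^sub>E UNIV U"
    using x by (auto simp: U_def)
  moreover have "Pi\<^sub>E UNIV U \<subseteq> {x \<in> {x. \<forall>i. x i \<in> A}. P x}"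
  proof
    fix y assume "y \<in> Pi\<^sub>E UNIV U"
    then have y: "y i \<in> U i" for i by auto
    then have "y i \<in> A" for i using x by (metis U_def singletonD)
    moreover have "x i = y i" if "\<bar>i\<bar> \<le> N" for i using y[of i] that by (simp add: U_def)
    ultimately show "y \<in> {x \<in> {x. \<forall>i. x i \<in> A}. P x}"
      using P[of x y] x by blast
  qed
  ultimately show "\<exists>U. finite {i \<in> UNIV. U i \<noteq> topspace (discrete_topology A)} \<and>
      (\<forall>i\<in>UNIV. openin (discrete_topology A) (U i)) \<and>
      x \<in> Pi\<^sub>E UNIV U \<and> Pi\<^sub>E UNIV U \<subseteq> {x \<in> {x. \<forall>i. x i \<in> A}. P x}"
    by blast
qed

lemma closedin_window:
  fixes N :: int
  assumes P: "\<And>x y. \<lbrakk>\<And>i. x i \<in> A; \<And>i. y i \<in> A; \<And>i. \<bar>i\<bar> \<le> N \<Longrightarrow> x i = y i; P x\<rbrakk> \<Longrightarrow> P y"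
  shows "closedin (full_shift A) {x \<in> topspace (full_shift A). P x}"
proof -
  have "openin (full_shift A) {x \<in> topspace (full_shift A). \<not> P x}"
    by (rule openin_window[of _ N]) (metis P)
  moreover have "topspace (full_shift A) - {x \<in> topspace (full_shift A). P x}
      = {x \<in> topspace (full_shift A). \<not> P x}"
    by auto
  ultimately show ?thesis
    by (simp add: closedin_def)
qed

lemma continuous_map_window:
  fixes N :: "int \<Rightarrow> int"
  assumes mem: "\<And>x i. (\<And>i. x i \<in> A) \<Longrightarrow> f x i \<in> B"
    and dep: "\<And>x y i. \<lbrakk>\<And>i. x i \<in> A; \<And>i. y i \<in> A; \<And>j. \<bar>j\<bar> \<le> N i \<Longrightarrow> x j = y j\<rbrakk> \<Longrightarrow> f x i = f y i"
  shows "continuous_map (full_shift A) (full_shift B) f"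
proof -
  have "continuous_map (full_shift A) (discrete_topology B) (\<lambda>x. f x i)" for i
    unfolding continuous_map_def
  proof (intro conjI allI impI)
    show "(\<lambda>x. f x i) \<in> topspace (full_shift A) \<rightarrow> topspace (discrete_topology B)"
      using mem by (auto simp: topspace_full_shift)
    show "openin (full_shift A) {x \<in> topspace (full_shift A). f x i \<in> U}" for U
      by (rule openin_window[of _ "N i"]) (metis dep)
  qed
  then show ?thesis
    by (subst (2) full_shift_def) (simp add: continuous_map_componentwise_UNIV)
qed

lemma full_shift_open_contains_window:
  assumes "openin (full_shift A) U" "x \<in> U"
  obtains N :: int where "\<And>y. \<lbrakk>\<And>i. y i \<in> A; \<And>i. \<bar>i\<bar> \<le> N \<Longrightarrow> y i = x i\<rbrakk> \<Longrightarrow> y \<in> U"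
proof -
  obtain V where V: "finite {i \<in> UNIV. V i \<noteq> topspace (discrete_topology A)}"
      "x \<in> Pi\<^sub>E UNIV V" "Pi\<^sub>E UNIV V \<subseteq> U"
    using assms unfolding full_shift_def openin_product_topology_alt by meson
  define N where "N = Max (insert 0 (abs ` {i. V i \<noteq> A}))"
  have N: "V i = A" if "\<not> \<bar>i\<bar> \<le> N" for i
  proof (rule ccontr)
    assume "V i \<noteq> A"
    then have "\<bar>i\<bar> \<le> N"
      unfolding N_def using V(1) by (intro Max_ge) auto
    with that show False by simp
  qed
  show thesis
  proof
    fix y assume y: "\<And>i. y i \<in> A" "\<And>i. \<bar>i\<bar> \<le> N \<Longrightarrow> y i = x i"
    have "y i \<in> V i" for i
      using y N V(2) by (cases "\<bar>i\<bar> \<le> N") (auto simp: PiE_def)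
    then show "y \<in> U" using V(3) by auto
  qed
qed

text \<open>Cylinders form a basis, so compactness turns continuity into dependence on one finite
  window, up to \<open>\<epsilon>\<close>.\<close>

lemma uniformly_continuous_window:
  fixes E :: "(int \<Rightarrow> 'a) \<Rightarrow> 'b::metric_space"
  assumes A: "finite A" and X: "closedin (full_shift A) X"
    and E: "continuous_map (subshift_topology A X) euclidean E" and "\<epsilon> > 0"
  obtains N :: nat where
    "\<And>x y. \<lbrakk>x \<in> X; y \<in> X; \<And>i. \<bar>i\<bar> \<le> int N \<Longrightarrow> x i = y i\<rbrakk> \<Longrightarrow> dist (E x) (E y) < \<epsilon>"
proof -
  have XA: "\<And>x i. x \<in> X \<Longrightarrow> x i \<in> A"
    using closedin_subset[OF X] by (auto simp: topspace_full_shift)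
  have tX: "topspace (subshift_topology A X) = X"
    using closedin_subset[OF X] by (auto simp: subshift_topology_def)
  define cyl where "cyl x n = {y \<in> topspace (full_shift A). \<forall>i. \<bar>i\<bar> \<le> n \<longrightarrow> y i = x i}"
    for x and n :: int
  have "\<exists>n. \<forall>y\<in>X \<inter> cyl x n. dist (E x) (E y) < \<epsilon> / 2" if "x \<in> X" for x
  proof -
    have "openin (subshift_topology A X) {y \<in> topspace (subshift_topology A X). E y \<in> ball (E x) (\<epsilon> / 2)}"
      using E by (rule openin_continuous_map_preimage) simp
    then obtain U where U: "openin (full_shift A) U" "{y \<in> X. E y \<in> ball (E x) (\<epsilon> / 2)} = U \<inter> X"
      unfolding tX by (auto simp: subshift_topology_def openin_subtopology)
    have "x \<in> {y \<in> X. E y \<in> ball (E x) (\<epsilon> / 2)}" using that \<open>\<epsilon> > 0\<close> by simp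
    then have "x \<in> U" using U(2) by blast
    with U(1) obtain n where "\<And>y. \<lbrakk>\<And>i. y i \<in> A; \<And>i. \<bar>i\<bar> \<le> n \<Longrightarrow> y i = x i\<rbrakk> \<Longrightarrow> y \<in> U"
      using full_shift_open_contains_window by blast
    then have "\<forall>y\<in>X \<inter> cyl x n. y \<in> U \<inter> X"
      by (auto simp: cyl_def topspace_full_shift)
    then show ?thesis unfolding U(2)[symmetric] by auto
  qed
  then obtain n where n: "\<And>x y. \<lbrakk>x \<in> X; y \<in> X; y \<in> cyl x (n x)\<rbrakk> \<Longrightarrow> dist (E x) (E y) < \<epsilon> / 2"
    by (metis IntI)
  have "compactin (full_shift A) X"
    using closedin_compact_space compact_space_full_shift[OF A] X by blast
  moreover have "\<forall>U\<in>(\<lambda>x. cyl x (n x)) ` X. openin (full_shift A) U"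
    unfolding cyl_def by (auto intro!: openin_window[where N = "n x" for x])
  moreover have "X \<subseteq> \<Union> ((\<lambda>x. cyl x (n x)) ` X)"
    using XA by (auto simp: cyl_def topspace_full_shift)
  ultimately obtain F where F: "finite F" "F \<subseteq> (\<lambda>x. cyl x (n x)) ` X" "X \<subseteq> \<Union>F"
    unfolding compactin_def by meson
  obtain Z where Z: "finite Z" "Z \<subseteq> X" "F = (\<lambda>x. cyl x (n x)) ` Z"
    using finite_subset_image[OF F(1,2)] by blast
  define N where "N = nat (Max (insert 0 (n ` Z)))"
  have N: "n z \<le> int N" if "z \<in> Z" for z
    unfolding N_def using Z(1) that by (simp add: le_nat_iff Max_ge_iff)
  show thesis
  proof
    fix x y assume xy: "x \<in> X" "y \<in> X" "\<And>i. \<bar>i\<bar> \<le> int N \<Longrightarrow> x i = y i"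
    obtain z where z: "z \<in> Z" "x \<in> cyl z (n z)" using F(3) Z(3) xy(1) by auto
    have "y \<in> cyl z (n z)"
      using z N[OF z(1)] xy XA[of y] by (auto simp: cyl_def topspace_full_shift)
    then have "dist (E z) (E x) < \<epsilon> / 2" "dist (E z) (E y) < \<epsilon> / 2"
      using n z xy Z(2) by blast+
    then show "dist (E x) (E y) < \<epsilon>"
      using dist_triangle_half_r[of "E z" "E x" \<epsilon> "E y"] by blast
  qed
qed

lemma shift_funpow: "(shift ^^ k) x i = x (i + int k)"
  by (induction k arbitrary: i) (auto simp: shift_def algebra_simps)

lemma inj_shift: "inj shift"
proof (rule injI)
  fix x y :: "int \<Rightarrow> 'a" assume "shift x = shift y"
  then have "x ((i - 1) + 1) = y ((i - 1) + 1)" for i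
    unfolding shift_def by meson
  then show "x = y" by auto
qed

lemma continuous_map_shift: "continuous_map (full_shift A) (full_shift A) shift"
  by (rule continuous_map_window[where N = "\<lambda>i. \<bar>i + 1\<bar>"]) (auto simp: shift_def)

lemma factor_append: "factor x i (l + m) = factor x i l @ factor x (i + int l) m"
  by (rule nth_equalityI) (auto simp: factor_def nth_append)

lemma length_factor [simp]: "length (factor x i l) = l"
  by (simp add: factor_def)

lemma nth_factor [simp]: "j < l \<Longrightarrow> factor x i l ! j = x (i + int j)"
  by (simp add: factor_def)

lemma factor_in_lists: "(\<And>i. x i \<in> A) \<Longrightarrow> factor x i l \<in> lists A"
  by (auto simp: factor_def)

lemma factor_eq_map_upto: "factor x i (nat (j - i + 1)) = map x [i..j]"
  by (rule nth_equalityI) auto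

lemma sublist_factor:
  assumes "j \<le> i" "i + int l \<le> j + int m"
  shows "sublist (factor x i l) (factor x j m)"
proof -
  define p where "p = nat (i - j)"
  define s where "s = m - p - l"
  have "m = p + (l + s)" "i = j + int p" using assms by (auto simp: p_def s_def)
  then have "factor x j m = factor x j p @ factor x i l @ factor x (i + int l) s"
    by (simp add: factor_append)
  then show ?thesis by (auto simp: sublist_def)
qed

section \<open>Substitutions acting on words and points\<close>

lemma substitution_append:
  "\<lbrakk>substitution A B t; u \<in> lists A; v \<in> lists A\<rbrakk> \<Longrightarrow> t (u @ v) = t u @ t v"
  by (simp add: substitution_def)

lemma substitution_in_lists: "\<lbrakk>substitution A B t; u \<in> lists A\<rbrakk> \<Longrightarrow> t u \<in> lists B"
  unfolding substitution_def by blast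

lemma substitution_Nil: "substitution A B t \<Longrightarrow> t [] = []"
  by (simp add: substitution_def)

lemma substitution_nonempty: "\<lbrakk>substitution A B t; a \<in> A\<rbrakk> \<Longrightarrow> 0 < length (t [a])"
  by (simp add: substitution_def)

lemma substitution_surj: "\<lbrakk>substitution A B t; b \<in> B\<rbrakk> \<Longrightarrow> \<exists>a\<in>A. b \<in> set (t [a])"
  by (simp add: substitution_def)

lemma substitution_sublist:
  assumes "substitution A B t" "sublist u v" "v \<in> lists A"
  shows "sublist (t u) (t v)"
proof -
  obtain p s where v: "v = p @ u @ s" using assms(2) by (auto simp: sublist_def)
  then have "p \<in> lists A" "u \<in> lists A" "s \<in> lists A" using assms(3) by auto
  then have "t v = t p @ t u @ t s"
    using v assms(1) by (simp add: substitution_append)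
  then show ?thesis by (auto simp: sublist_def)
qed

lemma sublist_singleton: "b \<in> set u \<Longrightarrow> sublist [b] u"
  by (metis append_Cons append_Nil split_list sublist_def)

lemma substitution_comp:
  assumes t: "substitution A B t" and s: "substitution B C s"
  shows "substitution A C (s \<circ> t)"
  unfolding substitution_def
proof (intro conjI ballI)
  show "s \<circ> t \<in> lists A \<rightarrow> lists C"
    by (intro funcsetI) (simp add: substitution_in_lists[OF s] substitution_in_lists[OF t])
  show "(s \<circ> t) [] = []"
    by (simp add: substitution_Nil[OF t] substitution_Nil[OF s])
  show "(s \<circ> t) (u @ v) = (s \<circ> t) u @ (s \<circ> t) v" if "u \<in> lists A" "v \<in> lists A" for u v
    using that by (simp add: substitution_append[OF t] substitution_append[OF s] substitution_in_lists[OF t])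
  show "(s \<circ> t) [a] \<noteq> []" if "a \<in> A" for a
  proof -
    have "0 < length (t [a])" "t [a] \<in> lists B"
      using that substitution_nonempty[OF t] substitution_in_lists[OF t, of "[a]"] by simp_all
    then have "0 < length (s (t [a]))"
      using length_substitution_ge[OF s, of "t [a]"] by linarith
    then show ?thesis by simp
  qed
  show "\<exists>a\<in>A. c \<in> set ((s \<circ> t) [a])" if "c \<in> C" for c
  proof -
    obtain b where b: "b \<in> B" "c \<in> set (s [b])" using substitution_surj[OF s \<open>c \<in> C\<close>] by blast
    obtain a where a: "a \<in> A" "b \<in> set (t [a])" using substitution_surj[OF t b(1)] by blast
    have "sublist (s [b]) (s (t [a]))"
      using a substitution_in_lists[OF t, of "[a]"] by (intro substitution_sublist[OF s] sublist_singleton) simp_all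
    then have "c \<in> set ((s \<circ> t) [a])"
      using set_mono_sublist b(2) by fastforce
    then show ?thesis using a(1) by blast
  qed
qed

lemma substitution_id: "substitution A A id"
  by (auto simp: substitution_def)

lemma length_substitution_bounds:
  assumes t: "substitution A B t" and u: "u \<in> lists A"
  shows "(\<And>b. b \<in> A \<Longrightarrow> m \<le> length (t [b])) \<Longrightarrow> m * length u \<le> length (t u)"
    and "(\<And>b. b \<in> A \<Longrightarrow> length (t [b]) \<le> M) \<Longrightarrow> length (t u) \<le> M * length u"
proof -
  have step: "length (t (a # u)) = length (t [a]) + length (t u)" if "a \<in> A" "u \<in> lists A" for a u
    using substitution_append[OF t, of "[a]" u] that by simp
  show "m * length u \<le> length (t u)" if m: "\<And>b. b \<in> A \<Longrightarrow> m \<le> length (t [b])"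
    using u
  proof (induction u)
    case (Cons a u)
    then show ?case using m[of a] step[of a u] by simp
  qed simp
  show "length (t u) \<le> M * length u" if M: "\<And>b. b \<in> A \<Longrightarrow> length (t [b]) \<le> M"
    using u
  proof (induction u)
    case (Cons a u)
    then show ?case using M[of a] step[of a u] by simp
  qed (simp add: substitution_Nil[OF t])
qed

text \<open>The position in \<open>apply_point t y\<close> at which the image of \<open>y i\<close> begins: the total length of
  the blocks between the origin and that block, counted negatively to the left of the origin.\<close>

definition block_start :: "('a list \<Rightarrow> 'b list) \<Rightarrow> (int \<Rightarrow> 'a) \<Rightarrow> int \<Rightarrow> int" where
  "block_start t y i =
     (if 0 \<le> i then int (length (t (factor y 0 (nat i))))
      else - int (length (t (factor y i (nat (- i))))))"

context
  fixes A :: "'a set" and B :: "'b set" and t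
  assumes t: "substitution A B t"
begin

context
  fixes y :: "int \<Rightarrow> 'a"
  assumes range: "range y \<subseteq> A"
begin

lemma letter_mem: "y i \<in> A"
  using range by auto

lemma factor_mem: "factor y i l \<in> lists A"
  by (rule factor_in_lists) (rule letter_mem)

lemma substitution_factor_append:
  "t (factor y i (l + m)) = t (factor y i l) @ t (factor y (i + int l) m)"
  by (simp add: factor_append substitution_append[OF t] factor_mem)

lemma block_start_0: "block_start t y 0 = 0"
  by (simp add: block_start_def factor_def substitution_Nil[OF t])

lemma factor_single: "factor y i 1 = [y i]"
  by (simp add: factor_def)

lemma block_start_Suc: "block_start t y (i + 1) = block_start t y i + int (length (t [y i]))"
proof (cases "0 \<le> i")
  case True
  then have "nat (i + 1) = nat i + 1" by simp
  then show ?thesis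
    using True substitution_factor_append[of 0 "nat i" 1] factor_single[of i] by (simp add: block_start_def)
next
  case False
  then have "nat (- i) = 1 + nat (- (i + 1))" by simp
  then have *: "length (t (factor y i (nat (- i)))) = length (t [y i]) + length (t (factor y (i + 1) (nat (- (i + 1)))))"
    using substitution_factor_append[of i 1 "nat (- (i + 1))"] factor_single[of i] by simp
  show ?thesis
  proof (cases "i = -1")
    case True
    then show ?thesis using * by (simp add: block_start_def factor_def substitution_Nil[OF t])
  next
    case False
    with \<open>\<not> 0 \<le> i\<close> have "\<not> 0 \<le> i + 1" by simp
    then show ?thesis using * \<open>\<not> 0 \<le> i\<close> by (simp add: block_start_def)
  qed
qed

lemma block_start_add: "block_start t y (i + int l) = block_start t y i + int (length (t (factor y i l)))"
proof (induction l)
  case 0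
  then show ?case by (simp add: factor_def substitution_Nil[OF t])
next
  case (Suc l)
  then show ?case
    using block_start_Suc[of "i + int l"] substitution_factor_append[of i l 1] factor_single[of "i + int l"]
    by (simp add: algebra_simps)
qed

lemma apply_point_letter:
  assumes "k < length (t [y i])"
  shows "apply_point t y (block_start t y i + int k) = t [y i] ! k"
proof (cases "0 \<le> i")
  case True
  then have "map y [0..i] = factor y 0 (nat i + 1)"
    using factor_eq_map_upto[where x = y and i = 0 and j = i] by (simp add: nat_add_distrib)
  then have w: "t (map y [0..i]) = t (factor y 0 (nat i)) @ t [y i]"
    using substitution_factor_append[of 0 "nat i" 1] factor_single[of i] True by simp
  have "block_start t y i + int k = int (length (t (factor y 0 (nat i))) + k)"
    using True by (simp add: block_start_def)
  then show ?thesis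
    using apply_point_right[OF t, where x = y and k = "length (t (factor y 0 (nat i))) + k" and j = i] assms letter_mem
    by (simp add: w)
next
  case False
  define L where "L = length (t (factor y i (nat (- i))))"
  have f: "map y [i..-1] = factor y i (nat (- i))"
    using factor_eq_map_upto[where x = y and i = i and j = "-1"] by simp
  have "nat (- i) = 1 + nat (- (i + 1))" using False by simp
  then have w: "t (map y [i..-1]) = t [y i] @ t (factor y (i + 1) (nat (- (i + 1))))"
    using substitution_factor_append[of i 1 "nat (- (i + 1))"] factor_single[of i] by (simp add: f)
  have L: "L = length (t (map y [i..-1]))" by (simp add: L_def f)
  then have "k < L" using assms w by simp
  then have "block_start t y i + int k = - int (L - Suc k) - 1"
    using False by (simp add: block_start_def L_def)
  then have "apply_point t y (block_start t y i + int k) = rev (t (map y [i..-1])) ! (L - Suc k)"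
    using apply_point_left[OF t, where x = y and k = "L - Suc k" and j = i] \<open>k < L\<close> L letter_mem by simp
  also have "\<dots> = t (map y [i..-1]) ! k"
    using \<open>k < L\<close> by (simp add: rev_nth L)
  also have "\<dots> = t [y i] ! k"
    using assms by (simp add: w nth_append)
  finally show ?thesis .
qed

text \<open>This reduces every computation with coordinates of an image to one with images of words.
  The two cases in the definition of \<open>apply_point\<close> are dealt with in the preceding lemma, for
  single letters; longer factors follow by appending one block at a time.\<close>

lemma factor_apply_point:
  "factor (apply_point t y) (block_start t y i) (length (t (factor y i l))) = t (factor y i l)"
proof (induction l)
  case 0
  then show ?case by (simp add: factor_def substitution_Nil[OF t])
next
  case (Suc l)
  have *: "t (factor y i (Suc l)) = t (factor y i l) @ t [y (i + int l)]"
    using substitution_factor_append[of i l 1] factor_single[of "i + int l"] by simp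
  have "factor (apply_point t y) (block_start t y (i + int l)) (length (t [y (i + int l)])) = t [y (i + int l)]"
    by (rule nth_equalityI) (simp_all add: apply_point_letter)
  then show ?case
    unfolding * length_append factor_append Suc block_start_add[symmetric] by simp
qed

lemma block_start_bounds: "block_start t y (- int N) \<le> - int N" "int N \<le> block_start t y (int N)"
proof -
  have "l \<le> length (t (factor y i l))" for i l
    using length_substitution_ge[OF t factor_mem] by (metis length_factor)
  from this[of N "- int N"] this[of N 0] block_start_add[of "- int N" N] block_start_add[of 0 N] block_start_0
  show "block_start t y (- int N) \<le> - int N" "int N \<le> block_start t y (int N)"
    by simp_all
qed

lemma factor_image_of_letter: "factor (apply_point t y) 0 (length (t [y 0])) = t [y 0]"
  using factor_apply_point[of 0 1] by (simp add: block_start_0 factor_def)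

lemma apply_point_window_sublist:
  "\<exists>j m. sublist (factor (apply_point t y) i l) (t (factor y j m))"
proof -
  define N where "N = nat (\<bar>i\<bar> + int l)"
  have N: "int N = \<bar>i\<bar> + int l" by (simp add: N_def)
  let ?w = "t (factor y (- int N) (2 * N))"
  have "block_start t y (- int N) \<le> i"
    using block_start_bounds(1)[of N] N by linarith
  moreover have "i + int l \<le> block_start t y (- int N) + int (length ?w)"
    using block_start_bounds(2)[of N] block_start_add[of "- int N" "2 * N"] N by simp
  ultimately have "sublist (factor (apply_point t y) i l) ?w"
    using sublist_factor[of "block_start t y (- int N)" i l "length ?w" "apply_point t y"]
    by (simp add: factor_apply_point)
  then show ?thesis by (intro exI)
qed

lemma apply_point_mem: "apply_point t y i \<in> B"
proof -
  obtain j m where "sublist (factor (apply_point t y) i 1) (t (factor y j m))"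
    using apply_point_window_sublist[of i 1] by (elim exE)
  then have "set (factor (apply_point t y) i 1) \<subseteq> set (t (factor y j m))"
    by (rule set_mono_sublist)
  moreover have "set (t (factor y j m)) \<subseteq> B"
    using substitution_in_lists[OF t factor_mem] by blast
  ultimately show ?thesis
    by (simp add: factor_def) blast
qed

end

lemma apply_point_cong:
  assumes "\<And>j. \<bar>j\<bar> \<le> \<bar>i\<bar> \<Longrightarrow> x j = y j"
  shows "apply_point t x i = apply_point t y i"
proof -
  have "map x [0..i] = map y [0..i]" if "0 \<le> i" using assms that by auto
  moreover have "map x [i..-1] = map y [i..-1]" if "\<not> 0 \<le> i" using assms that by auto
  ultimately show ?thesis by (cases "0 \<le> i") (simp_all add: apply_point_def del: map_eq_conv)
qed

lemma continuous_map_apply_point: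
  "continuous_map (full_shift A) (full_shift B) (apply_point t)"
proof (rule continuous_map_window[where N = abs])
  show "apply_point t x i \<in> B" if "\<And>i. x i \<in> A" for x i
    using that by (intro apply_point_mem) auto
qed (rule apply_point_cong)

text \<open>Both sides are concatenations of the same blocks, and the block of \<open>y 1\<close> begins at \<open>0\<close>
  in both, so they agree on the image of every window of \<open>shift y\<close>.\<close>

lemma apply_point_shift:
  fixes y :: "int \<Rightarrow> 'a"
  assumes y: "range y \<subseteq> A"
  shows "apply_point t (shift y) = (shift ^^ length (t [y 0])) (apply_point t y)"
proof
  fix m :: int
  define h where "h = length (t [y 0])"
  have Sy: "range (shift y) \<subseteq> A" using y by (auto simp: shift_def)
  have fS: "factor (shift y) i l = factor y (i + 1) l" for i l
    by (simp add: factor_def shift_def algebra_simps)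
  have bs: "block_start t (shift y) i = block_start t y (i + 1) - int h" for i
  proof -
    have nn: "block_start t (shift y) (int n) = block_start t y (int n + 1) - int h" for n
      using block_start_add[OF Sy, of 0 n] block_start_add[OF y, of 1 n] block_start_Suc[OF y, of 0]
      by (simp add: block_start_0[OF Sy] block_start_0[OF y] fS h_def add.commute)
    have np: "block_start t (shift y) (- int n) = block_start t y (- int n + 1) - int h" for n
      using block_start_add[OF Sy, of "- int n" n] block_start_add[OF y, of "- int n + 1" n] block_start_Suc[OF y, of 0]
      by (simp add: block_start_0[OF Sy] block_start_0[OF y] fS h_def algebra_simps)
    show ?thesis using nn[of "nat i"] np[of "nat (- i)"] by (cases "0 \<le> i") auto
  qed
  define N where "N = nat (\<bar>m\<bar> + 1)"
  have N: "int N = \<bar>m\<bar> + 1" by (simp add: N_def)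
  let ?w = "t (factor (shift y) (- int N) (2 * N))"
  define p where "p = block_start t (shift y) (- int N)"
  have p: "p \<le> - int N" "int N \<le> p + int (length ?w)"
    using block_start_bounds[OF Sy, of N] block_start_add[OF Sy, of "- int N" "2 * N"] by (simp_all add: p_def)
  have w1: "factor (apply_point t (shift y)) p (length ?w) = ?w"
    unfolding p_def by (rule factor_apply_point[OF Sy])
  have w2: "factor (apply_point t y) (p + int h) (length ?w) = ?w"
    using factor_apply_point[OF y, of "- int N + 1" "2 * N"] by (simp add: fS p_def bs)
  define k where "k = nat (m - p)"
  have k: "k < length ?w" "m = p + int k" using p N by (auto simp: k_def)
  have "apply_point t (shift y) m = ?w ! k"
    using arg_cong[OF w1, of "\<lambda>w. w ! k"] k by simp
  moreover have "apply_point t y (m + int h) = ?w ! k"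
    using arg_cong[OF w2, of "\<lambda>w. w ! k"] k by (simp add: algebra_simps)
  ultimately show "apply_point t (shift y) m = (shift ^^ length (t [y 0])) (apply_point t y) m"
    by (simp add: shift_funpow h_def)
qed

end

section \<open>The levels of a directive sequence\<close>

lemma compose_self [simp]: "compose \<tau> n n = id"
  by (simp add: compose_def)

lemma compose_trans:
  assumes "n \<le> m" "m \<le> p"
  shows "compose \<tau> n p = compose \<tau> n m \<circ> compose \<tau> m p"
proof -
  have "foldr (\<circ>) fs (g :: 'a list \<Rightarrow> 'a list) = foldr (\<circ>) fs id \<circ> g" for fs and g
    by (induction fs) (auto simp: o_assoc[symmetric])
  moreover have "[n..<p] = [n..<m] @ [m..<p]"
    using assms upt_add_eq_append[of n m "p - m"] by simp
  ultimately show ?thesis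
    by (metis compose_def foldr_append map_append)
qed

lemma compose_Suc_right: "n \<le> m \<Longrightarrow> compose \<tau> n (Suc m) = compose \<tau> n m \<circ> \<tau> m"
  by (simp add: compose_trans[of n m "Suc m"]) (simp add: compose_def)

definition level_words where
  "level_words A \<tau> n = {w. \<exists>m>n. \<exists>a\<in>A m. sublist w (compose \<tau> n m [a])}"

lemma level_shift_iff:
  "x \<in> level_shift A \<tau> n \<longleftrightarrow> (\<forall>i. x i \<in> A n) \<and> (\<forall>i l. factor x i l \<in> level_words A \<tau> n)"
  by (simp add: level_shift_def level_words_def topspace_full_shift)

lemma level_words_sublist: "\<lbrakk>w \<in> level_words A \<tau> n; sublist v w\<rbrakk> \<Longrightarrow> v \<in> level_words A \<tau> n"
  unfolding level_words_def by (auto dest: sublist_order.order.trans)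

lemma level_shift_letters: "x \<in> level_shift A \<tau> n \<Longrightarrow> x i \<in> A n"
  by (simp add: level_shift_iff)

lemma level_shift_range: "x \<in> level_shift A \<tau> n \<Longrightarrow> range x \<subseteq> A n"
  by (auto simp: level_shift_iff)

lemma closedin_level_shift: "closedin (full_shift (A n)) (level_shift A \<tau> n)"
proof -
  have "closedin (full_shift (A n)) {x \<in> topspace (full_shift (A n)). factor x i l \<in> level_words A \<tau> n}" for i l
  proof (rule closedin_window[where N = "\<bar>i\<bar> + int l"])
    fix x y :: "int \<Rightarrow> 'a"
    assume eq: "\<And>j. \<bar>j\<bar> \<le> \<bar>i\<bar> + int l \<Longrightarrow> x j = y j"
    have "factor x i l = factor y i l"
      by (rule nth_equalityI) (auto intro!: eq)
    then show "factor x i l \<in> level_words A \<tau> n \<Longrightarrow> factor y i l \<in> level_words A \<tau> n" by simp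
  qed
  then have "closedin (full_shift (A n))
      (\<Inter>(i, l)\<in>UNIV. {x \<in> topspace (full_shift (A n)). factor x i l \<in> level_words A \<tau> n})"
    by (intro closedin_INT) auto
  moreover have "(\<Inter>(i, l)\<in>UNIV. {x \<in> topspace (full_shift (A n)). factor x i l \<in> level_words A \<tau> n})
      = level_shift A \<tau> n"
    by (auto simp: level_shift_iff topspace_full_shift)
  ultimately show ?thesis by simp
qed

lemma shift_level_shift: "x \<in> level_shift A \<tau> n \<Longrightarrow> shift x \<in> level_shift A \<tau> n"
proof -
  have "factor (shift x) i l = factor x (i + 1) l" for i l
    by (simp add: factor_def shift_def algebra_simps)
  then show "x \<in> level_shift A \<tau> n \<Longrightarrow> shift x \<in> level_shift A \<tau> n"
    by (auto simp: level_shift_iff) (simp add: shift_def)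
qed

lemma shift_funpow_level_shift: "x \<in> level_shift A \<tau> n \<Longrightarrow> (shift ^^ k) x \<in> level_shift A \<tau> n"
  by (induction k) (auto intro: shift_level_shift)

locale directive =
  fixes A :: "nat \<Rightarrow> 'a set" and \<tau> :: "nat \<Rightarrow> 'a list \<Rightarrow> 'a list"
  assumes directive: "directive_sequence A \<tau>"
begin

lemma finite_alphabet: "finite (A n)"
  using directive by (simp add: directive_sequence_def alphabet_def)

lemma two_letters: "2 \<le> card (A n)"
  using directive by (simp add: directive_sequence_def alphabet_def)

lemma substitution_compose:
  assumes "n \<le> m"
  shows "substitution (A m) (A n) (compose \<tau> n m)"
  using assms
proof (induction m rule: dec_induct)
  case base
  then show ?case by (simp only: compose_self substitution_id)
next
  case (step m)
  have "substitution (A (Suc m)) (A m) (\<tau> m)"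
    using directive by (simp add: directive_sequence_def)
  then show ?case
    using step substitution_comp by (simp only: compose_Suc_right) blast
qed

text \<open>Every letter occurs in the image of some letter of the next level, so a word of level \<open>n\<close>
  can be found in images from arbitrarily deep levels.\<close>

lemma level_words_deep:
  assumes "w \<in> level_words A \<tau> n"
  shows "\<exists>m>p. n < m \<and> (\<exists>a\<in>A m. sublist w (compose \<tau> n m [a]))"
proof -
  obtain m a where m: "n < m" "a \<in> A m" "sublist w (compose \<tau> n m [a])"
    using assms by (auto simp: level_words_def)
  let ?q = "Suc (max m p)"
  have s: "substitution (A ?q) (A m) (compose \<tau> m ?q)"
    by (rule substitution_compose) simp
  then obtain b where b: "b \<in> A ?q" "a \<in> set (compose \<tau> m ?q [b])"
    using substitution_surj[OF s m(2)] by blast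
  have "compose \<tau> m ?q [b] \<in> lists (A m)"
    using substitution_in_lists[OF s] b by simp
  then have "sublist (compose \<tau> n m [a]) (compose \<tau> n m (compose \<tau> m ?q [b]))"
    using b m by (intro substitution_sublist[OF substitution_compose] sublist_singleton) auto
  then have "sublist w (compose \<tau> n m (compose \<tau> m ?q [b]))"
    by (rule sublist_order.order.trans[OF m(3)])
  also have "compose \<tau> n m (compose \<tau> m ?q [b]) = compose \<tau> n ?q [b]"
    using m compose_trans[of n m ?q \<tau>] by simp
  finally have "sublist w (compose \<tau> n ?q [b])" .
  moreover have "p < ?q" "n < ?q" using m by auto
  ultimately show ?thesis using b(1) by blast
qed

lemma level_words_image:
  assumes "w \<in> level_words A \<tau> m" "n \<le> m"
  shows "compose \<tau> n m w \<in> level_words A \<tau> n"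
proof -
  obtain p a where p: "m < p" "a \<in> A p" "sublist w (compose \<tau> m p [a])"
    using assms by (auto simp: level_words_def)
  have "compose \<tau> m p [a] \<in> lists (A m)"
    using p substitution_in_lists[OF substitution_compose[of m p]] by simp
  then have "sublist (compose \<tau> n m w) (compose \<tau> n m (compose \<tau> m p [a]))"
    using p assms by (intro substitution_sublist[OF substitution_compose]) auto
  then have "sublist (compose \<tau> n m w) (compose \<tau> n p [a])"
    using p assms by (simp add: compose_trans[of n m p])
  moreover have "n < p" using p assms by simp
  ultimately show ?thesis
    unfolding level_words_def using p(2) by blast
qed

lemma apply_point_level:
  assumes "y \<in> level_shift A \<tau> n"
  shows "apply_point (compose \<tau> 0 n) y \<in> level_shift A \<tau> 0"
  unfolding level_shift_iff
proof (intro conjI allI)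
  note y = level_shift_range[OF assms]
  have t: "substitution (A n) (A 0) (compose \<tau> 0 n)" by (rule substitution_compose) simp
  show "apply_point (compose \<tau> 0 n) y i \<in> A 0" for i
    by (rule apply_point_mem[OF t y])
  fix i l
  obtain j m where "sublist (factor (apply_point (compose \<tau> 0 n) y) i l) (compose \<tau> 0 n (factor y j m))"
    using apply_point_window_sublist[OF t y, of i l] by (elim exE)
  moreover have "compose \<tau> 0 n (factor y j m) \<in> level_words A \<tau> 0"
    using assms by (intro level_words_image) (simp_all add: level_shift_iff)
  ultimately show "factor (apply_point (compose \<tau> 0 n) y) i l \<in> level_words A \<tau> 0"
    by (rule level_words_sublist[rotated])
qed

lemma closedin_base: "closedin (full_shift (A 0)) (base A \<tau> n a)"
proof -
  have t: "substitution (A n) (A 0) (compose \<tau> 0 n)" by (rule substitution_compose) simp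
  let ?F = "full_shift (A n)" and ?Y = "{y \<in> level_shift A \<tau> n. y 0 = a}"
  have "closedin ?F {y \<in> topspace ?F. y 0 = a}"
    by (rule closedin_window[of _ 0]) auto
  then have "closedin ?F (level_shift A \<tau> n \<inter> {y \<in> topspace ?F. y 0 = a})"
    using closedin_level_shift by (rule closedin_Int[rotated])
  moreover have "level_shift A \<tau> n \<inter> {y \<in> topspace ?F. y 0 = a} = ?Y"
    using closedin_subset[OF closedin_level_shift[of A n \<tau>]] by blast
  ultimately have "closedin ?F ?Y" by simp
  then have "compactin ?F ?Y"
    by (rule closedin_compact_space[OF compact_space_full_shift[OF finite_alphabet]])
  then have "compactin (full_shift (A 0)) (apply_point (compose \<tau> 0 n) ` ?Y)"
    using continuous_map_apply_point[OF t] by (rule image_compactin)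
  then have "closedin (full_shift (A 0)) (apply_point (compose \<tau> 0 n) ` ?Y)"
    by (rule compactin_imp_closedin[OF Hausdorff_space_full_shift])
  also have "apply_point (compose \<tau> 0 n) ` ?Y = base A \<tau> n a"
    unfolding base_def by blast
  finally show ?thesis .
qed

section \<open>Desubstitution of points\<close>

text \<open>A long factor of \<open>x\<close> around the origin lies in
  \<open>compose \<tau> 0 n u\<close> for a word \<open>u\<close> of level \<open>n\<close>.  The letter of \<open>u\<close> whose image covers the
  origin has many letters of \<open>u\<close> on both sides, and placing it at coordinate \<open>0\<close> gives the
  point \<open>y\<close>; outside of \<open>u\<close> it is filled with an arbitrary letter.\<close>

lemma desubstitute_window:
  assumes x: "x \<in> level_shift A \<tau> 0"
  shows "\<exists>y k. range y \<subseteq> A n \<and> k < length (compose \<tau> 0 n [y 0]) \<and>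
     factor y (- int K) (2 * K + 1) \<in> level_words A \<tau> n \<and>
     (\<forall>i. \<bar>i\<bar> \<le> int K \<longrightarrow> apply_point (compose \<tau> 0 n) y (i + int k) = x i)"
proof -
  define t where "t = compose \<tau> 0 n"
  have t: "substitution (A n) (A 0) t"
    unfolding t_def by (rule substitution_compose) simp
  define H where "H = Max ((\<lambda>a. length (t [a])) ` A n)"
  have H: "length (t [a]) \<le> H" if "a \<in> A n" for a
    unfolding H_def using that finite_alphabet by (intro Max_ge) auto
  obtain a0 where a0: "a0 \<in> A n" using two_letters[of n] by fastforce
  have "H > 0" using substitution_nonempty[OF t a0] H[OF a0] by linarith
  \<comment> \<open>Blocks have length at most \<open>H\<close>, so \<open>N\<close> symbols on one side of the origin meet more than
    \<open>K\<close> of them.\<close>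
  define N where "N = H * (K + 1)"
  have "factor x (- int N) (2 * N + 1) \<in> level_words A \<tau> 0"
    using x by (simp add: level_shift_iff)
  then obtain m b where m: "m > n" "b \<in> A m" "sublist (factor x (- int N) (2 * N + 1)) (compose \<tau> 0 m [b])"
    using level_words_deep[of _ 0 n] by blast
  define u where "u = compose \<tau> n m [b]"
  have uA: "u \<in> lists (A n)"
    unfolding u_def using m substitution_in_lists[OF substitution_compose[of n m]] by simp
  have u_words: "u \<in> level_words A \<tau> n"
    using m by (auto simp: u_def level_words_def)
  have "compose \<tau> 0 m [b] = t u"
    using m by (simp add: u_def t_def compose_trans[of 0 n m])
  then obtain ps ss where tu: "t u = ps @ factor x (- int N) (2 * N + 1) @ ss"
    using m(3) by (auto simp: sublist_def)
  define q where "q = length ps + N"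
  have len_tu: "length (t u) = q + N + 1 + length ss"
    by (simp add: tu q_def)
  define pos where "pos j = length (t (take j u))" for j
  have pos_Suc: "pos (Suc j) = pos j + length (t [u ! j])" if "j < length u" for j
  proof -
    have "take j u \<in> lists (A n)" "[u ! j] \<in> lists (A n)"
      using uA that by (auto dest: in_set_takeD)
    then show ?thesis
      using that by (simp add: pos_def take_Suc_conv_app_nth substitution_append[OF t])
  qed
  \<comment> \<open>\<open>j\<close> is the index of the letter of \<open>u\<close> whose image covers position \<open>q\<close>, the origin of \<open>x\<close>.\<close>
  define j where "j = (LEAST j. q < pos (Suc j))"
  have ex: "q < pos (Suc (length u))"
    using len_tu by (simp add: pos_def)
  have jq: "q < pos (Suc j)"
    unfolding j_def using ex by (rule LeastI)
  have pj: "pos j \<le> q"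
  proof (cases j)
    case 0
    then show ?thesis by (simp add: pos_def substitution_Nil[OF t])
  next
    case (Suc i)
    then have "\<not> q < pos (Suc i)" using not_less_Least[of i "\<lambda>j. q < pos (Suc j)"] by (simp add: j_def)
    then show ?thesis using Suc by simp
  qed
  have ju: "j < length u"
  proof (rule ccontr)
    assume "\<not> j < length u"
    then have "pos j = length (t u)" by (simp add: pos_def)
    then show False using pj len_tu by simp
  qed
  have uj: "u ! j \<in> A n" using uA ju by (auto simp: lists_eq_set)
  have t_u_split: "t u = t (take j u) @ t (drop j u)"
    using substitution_append[OF t, of "take j u" "drop j u"] uA
    by (auto dest: in_set_takeD in_set_dropD)
  have left: "K \<le> j"
  proof -
    have "take (Suc j) u \<in> lists (A n)" using uA by (auto dest: in_set_takeD)
    then have "pos (Suc j) \<le> H * length (take (Suc j) u)"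
      unfolding pos_def by (rule length_substitution_bounds(2)[OF t]) (rule H)
    also have "length (take (Suc j) u) = Suc j" using ju by simp
    finally have "H * (K + 1) < H * Suc j" using jq unfolding q_def N_def by linarith
    then have "K + 1 < Suc j" by (simp only: mult_less_cancel1)
    then show ?thesis by simp
  qed
  have right: "j + K < length u"
  proof -
    have "drop j u \<in> lists (A n)" using uA by (auto dest: in_set_dropD)
    then have "length (t (drop j u)) \<le> H * length (drop j u)"
      by (rule length_substitution_bounds(2)[OF t]) (rule H)
    moreover have "length (t u) = pos j + length (t (drop j u))"
      by (simp add: t_u_split pos_def)
    ultimately have "H * (K + 1) < H * (length u - j)"
      using pj len_tu by (simp add: N_def)
    then have "K + 1 < length u - j" by (simp only: mult_less_cancel1)
    then show ?thesis by simp
  qed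
  define y where "y i = (if 0 \<le> int j + i \<and> int j + i < int (length u) then u ! nat (int j + i) else a0)" for i
  have y: "range y \<subseteq> A n"
    using uA a0 by (auto simp: y_def)
  have fac: "factor y (int i - int j) l = take l (drop i u)" if "i + l \<le> length u" for i l
    using that by (intro nth_equalityI) (auto simp: y_def nat_int_add)
  have y0: "y 0 = u ! j" using ju by (simp add: y_def)
  define k where "k = q - pos j"
  have k: "k < length (t [y 0])"
    using jq pj pos_Suc[OF ju] by (simp add: k_def y0)
  have "factor y (- int K) (2 * K + 1) = take (2 * K + 1) (drop (j - K) u)"
    using fac[of "j - K" "2 * K + 1"] left right by (simp add: of_nat_diff)
  also have "sublist \<dots> u"
    by (meson sublist_drop sublist_order.order.trans sublist_take)
  finally have y_words: "factor y (- int K) (2 * K + 1) \<in> level_words A \<tau> n"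
    by (rule level_words_sublist[OF u_words])
  have fu: "factor y (- int j) (length u) = u" "factor y (- int j) j = take j u"
    using fac[of 0 "length u"] fac[of 0 j] ju by simp_all
  have bs: "block_start t y (- int j) = - int (pos j)"
    using block_start_add[OF t y, of "- int j" j] by (simp add: block_start_0[OF t y] fu pos_def)
  have img: "factor (apply_point t y) (- int (pos j)) (length (t u)) = t u"
    using factor_apply_point[OF t y, of "- int j" "length u"] by (simp add: fu bs)
  have "apply_point t y (i + int k) = x i" if i: "\<bar>i\<bar> \<le> int K" for i
  proof -
    have "K \<le> N" using \<open>H > 0\<close> by (cases H) (auto simp: N_def)
    define c where "c = nat (int N + i)"
    have c: "int c = int N + i" "c < 2 * N + 1"
      using i \<open>K \<le> N\<close> by (auto simp: c_def)
    then have "length ps + c < length (t u)" by (simp add: tu)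
    then have "apply_point t y (- int (pos j) + int (length ps + c)) = t u ! (length ps + c)"
      using arg_cong[OF img, of "\<lambda>w. w ! (length ps + c)"] by simp
    also have "t u ! (length ps + c) = x i"
      using c by (simp add: tu nth_append)
    also have "- int (pos j) + int (length ps + c) = i + int k"
      using pj c by (simp add: k_def q_def of_nat_diff)
    finally show ?thesis .
  qed
  with y k y_words show ?thesis
    unfolding t_def by blast
qed

text \<open>The points obtained by desubstituting larger and larger windows accumulate, by compactness,
  at a point of level \<open>n\<close> whose image is a translate of \<open>x\<close>.\<close>

theorem level_shift_covered:
  assumes x: "x \<in> level_shift A \<tau> 0"
  obtains y k where "y \<in> level_shift A \<tau> n" "k < length (compose \<tau> 0 n [y 0])"
    "x = (shift ^^ k) (apply_point (compose \<tau> 0 n) y)"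
proof -
  define t where "t = compose \<tau> 0 n"
  have t: "substitution (A n) (A 0) t"
    unfolding t_def by (rule substitution_compose) simp
  define H where "H = Max ((\<lambda>a. length (t [a])) ` A n)"
  have H: "length (t [a]) \<le> H" if "a \<in> A n" for a
    unfolding H_def using that finite_alphabet by (intro Max_ge) auto
  define P where "P k K y \<longleftrightarrow> k < length (t [y 0]) \<and>
     factor y (- int K) (2 * K + 1) \<in> level_words A \<tau> n \<and>
     (\<forall>i. \<bar>i\<bar> \<le> int K \<longrightarrow> apply_point t y (i + int k) = x i)" for k K y
  define D where "D k K = {y \<in> topspace (full_shift (A n)). P k K y}" for k K
  have P_mono: "P k K y" if "P k L y" "K \<le> L" for k K L y
  proof -
    have "sublist (factor y (- int K) (2 * K + 1)) (factor y (- int L) (2 * L + 1))"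
      using that by (intro sublist_factor) auto
    moreover have "factor y (- int L) (2 * L + 1) \<in> level_words A \<tau> n"
      using that by (simp add: P_def)
    ultimately have "factor y (- int K) (2 * K + 1) \<in> level_words A \<tau> n"
      by (rule level_words_sublist[rotated])
    then show ?thesis
      using that by (simp add: P_def)
  qed
  have "\<exists>y k. y \<in> D k K" for K
    using desubstitute_window[OF x, of n K]
    unfolding D_def P_def t_def topspace_full_shift by (simp add: image_subset_iff)
  then obtain k where k: "\<And>K. \<exists>y. y \<in> D (k K) K" by metis
  have "k K \<le> H" for K
  proof -
    obtain y where "y \<in> D (k K) K" using k by blast
    then have "k K < length (t [y 0])" "y 0 \<in> A n"
      by (auto simp: D_def P_def topspace_full_shift)
    then show ?thesis using H[of "y 0"] by simp
  qed
  then have "finite (range k)"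
    by (auto intro!: finite_subset[of _ "{..H}", OF _ finite_atMost])
  \<comment> \<open>The offset \<open>k\<close> is bounded, so one value serves windows of all sizes.\<close>
  then obtain K0 where K0: "infinite {K. k K = k K0}"
    using pigeonhole_infinite[of UNIV k] by (auto simp: Collect_conj_eq)
  have ne: "D (k K0) K \<noteq> {}" for K
  proof -
    obtain L where "L > K" "k L = k K0"
      using K0 unfolding infinite_nat_iff_unbounded by blast
    moreover obtain y where "y \<in> D (k L) L" using k by blast
    ultimately have "y \<in> D (k K0) K"
      using P_mono[where k = "k K0" and L = L and y = y and K = K] unfolding D_def by simp
    then show ?thesis by blast
  qed
  have "closedin (full_shift (A n)) (D (k K0) K)" for K
    unfolding D_def
  proof (rule closedin_window[where N = "int (K + k K0)"])
    fix y z :: "int \<Rightarrow> 'a"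
    assume eq: "\<And>i. \<bar>i\<bar> \<le> int (K + k K0) \<Longrightarrow> y i = z i" and P: "P (k K0) K y"
    have "factor y (- int K) (2 * K + 1) = factor z (- int K) (2 * K + 1)"
      by (rule nth_equalityI) (auto intro!: eq)
    moreover have "apply_point t y (i + int (k K0)) = apply_point t z (i + int (k K0))" if "\<bar>i\<bar> \<le> int K" for i
      using that by (intro apply_point_cong[OF t]) (auto intro!: eq)
    ultimately show "P (k K0) K z"
      using P eq[of 0] by (simp add: P_def)
  qed
  moreover have "decseq (D (k K0))"
    unfolding decseq_def D_def using P_mono by blast
  ultimately have "(\<Inter>K. D (k K0) K) \<noteq> {}"
    using ne by (intro compact_space_imp_nest[OF compact_space_full_shift[OF finite_alphabet]])
  then obtain y where y: "\<And>K. y \<in> D (k K0) K" by blast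
  have "y \<in> level_shift A \<tau> n"
    unfolding level_shift_iff
  proof (intro conjI allI)
    show "y i \<in> A n" for i using y[of 0] by (simp add: D_def topspace_full_shift)
    fix i l
    define K where "K = nat \<bar>i\<bar> + l"
    have "sublist (factor y i l) (factor y (- int K) (2 * K + 1))"
      by (intro sublist_factor) (auto simp: K_def)
    then show "factor y i l \<in> level_words A \<tau> n"
      using y[of K] level_words_sublist[of "factor y (- int K) (2 * K + 1)"] by (simp add: D_def P_def)
  qed
  moreover have "k K0 < length (t [y 0])"
    using y[of 0] by (simp add: D_def P_def)
  moreover have "x = (shift ^^ k K0) (apply_point t y)"
  proof
    show "x i = (shift ^^ k K0) (apply_point t y) i" for i
      using y[of "nat \<bar>i\<bar>"] by (simp add: D_def P_def shift_funpow)
  qed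
  ultimately show thesis
    unfolding t_def by (rule that)
qed

end

section \<open>Towers and their measure\<close>

lemma sets_borel_on: "sets (borel_on T) = sigma_sets (topspace T) {U. openin T U}"
  unfolding borel_on_def by (rule sets_measure_of) (auto dest: openin_subset)

lemma closedin_sets_borel_on:
  assumes "closedin T C"
  shows "C \<in> sets (borel_on T)"
proof -
  have "topspace T - C \<in> {U. openin T U}"
    using assms by (simp add: closedin_def)
  then have "topspace T - (topspace T - C) \<in> sigma_sets (topspace T) {U. openin T U}"
    by (intro sigma_sets.Compl sigma_sets.Basic)
  then show ?thesis
    using closedin_subset[OF assms] by (simp add: sets_borel_on double_diff)
qed

lemma continuous_imp_measurable_borel_on:
  fixes f :: "'b \<Rightarrow> 'c::topological_space"
  assumes f: "continuous_map T euclidean f" and M: "sets M = sets (borel_on T)"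
  shows "f \<in> borel_measurable M"
proof (rule borel_measurableI)
  fix U :: "'c set" assume "open U"
  then have "openin T {x \<in> topspace T. f x \<in> U}"
    using f by (simp add: openin_continuous_map_preimage)
  moreover have "f -` U \<inter> space M = {x \<in> topspace T. f x \<in> U}"
  proof -
    have "space M = topspace T"
      using sets_eq_imp_space_eq[OF M] by (simp add: borel_on_def space_measure_of_conv)
    then show ?thesis by auto
  qed
  ultimately show "f -` U \<inter> space M \<in> sets M"
    by (simp add: M sets_borel_on)
qed

lemma continuous_imp_measurable_self:
  assumes f: "continuous_map T T f" and M: "sets M = sets (borel_on T)"
  shows "f \<in> measurable M M"
proof -
  have sp: "space M = topspace T"
    using sets_eq_imp_space_eq[OF M] by (simp add: borel_on_def space_measure_of_conv)
  show ?thesis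
  proof (rule measurable_sigma_sets)
    show "sets M = sigma_sets (topspace T) {U. openin T U}" by (simp add: M sets_borel_on)
    show "{U. openin T U} \<subseteq> Pow (topspace T)" by (auto dest: openin_subset)
    show "f \<in> space M \<rightarrow> topspace T"
      using continuous_map_funspace[OF f] by (simp add: sp)
    show "f -` U \<inter> space M \<in> sets M" if "U \<in> {U. openin T U}" for U
    proof -
      have "openin T {x \<in> topspace T. f x \<in> U}"
        using f that by (simp add: openin_continuous_map_preimage)
      moreover have "f -` U \<inter> space M = {x \<in> topspace T. f x \<in> U}"
        by (auto simp: sp)
      ultimately show ?thesis by (simp add: M sets_borel_on)
    qed
  qed
qed

definition tower :: "(nat \<Rightarrow> 'a set) \<Rightarrow> (nat \<Rightarrow> 'a list \<Rightarrow> 'a list) \<Rightarrow> nat \<Rightarrow> 'a \<Rightarrow> nat \<Rightarrow> (int \<Rightarrow> 'a) set" where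
  "tower A \<tau> n a k = (shift ^^ k) ` base A \<tau> n a"

lemma shift_tower: "x \<in> tower A \<tau> n a k \<Longrightarrow> shift x \<in> tower A \<tau> n a (Suc k)"
  by (auto simp: tower_def)

lemma tower_cases:
  assumes "x \<in> tower A \<tau> n a k"
  obtains y where "y \<in> level_shift A \<tau> n" "y 0 = a" "x = (shift ^^ k) (apply_point (compose \<tau> 0 n) y)"
  using assms by (auto simp: tower_def base_def)

lemma tower_intro:
  "y \<in> level_shift A \<tau> n \<Longrightarrow> (shift ^^ k) (apply_point (compose \<tau> 0 n) y) \<in> tower A \<tau> n (y 0) k"
  by (auto simp: tower_def base_def)

context directive
begin

lemma tower_subset: "tower A \<tau> n a k \<subseteq> level_shift A \<tau> 0"
  unfolding tower_def base_def
  using apply_point_level shift_funpow_level_shift by blast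

lemma closedin_tower: "closedin (full_shift (A 0)) (tower A \<tau> n a k)"
proof (induction k)
  case 0
  show ?case using closedin_base by (simp add: tower_def)
next
  case (Suc k)
  have "compactin (full_shift (A 0)) (tower A \<tau> n a k)"
    by (rule closedin_compact_space[OF compact_space_full_shift[OF finite_alphabet] Suc])
  then have "compactin (full_shift (A 0)) (shift ` tower A \<tau> n a k)"
    using continuous_map_shift by (rule image_compactin)
  then have "closedin (full_shift (A 0)) (shift ` tower A \<tau> n a k)"
    by (rule compactin_imp_closedin[OF Hausdorff_space_full_shift])
  also have "shift ` tower A \<tau> n a k = tower A \<tau> n a (Suc k)"
    by (auto simp: tower_def image_image)
  finally show ?case .
qed

lemma tower_cover:
  assumes "x \<in> level_shift A \<tau> 0"
  obtains a k where "a \<in> A n" "k < length (compose \<tau> 0 n [a])" "x \<in> tower A \<tau> n a k"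
proof -
  obtain y k where y: "y \<in> level_shift A \<tau> n" "k < length (compose \<tau> 0 n [y 0])"
      "x = (shift ^^ k) (apply_point (compose \<tau> 0 n) y)"
    using level_shift_covered[OF assms] .
  then show thesis
    using that[of "y 0" k] tower_intro[OF y(1)] level_shift_letters by metis
qed

lemma tower_unique:
  assumes "recognizable A \<tau>" "1 \<le> n"
    and "a \<in> A n" "k < length (compose \<tau> 0 n [a])" "x \<in> tower A \<tau> n a k"
    and "b \<in> A n" "l < length (compose \<tau> 0 n [b])" "x \<in> tower A \<tau> n b l"
  shows "a = b \<and> k = l"
proof (rule ccontr)
  assume "\<not> (a = b \<and> k = l)"
  then have "(a, k) \<noteq> (b, l)" by simp
  moreover have "disjoint_family_on (\<lambda>(a, k). tower A \<tau> n a k) (SIGMA a:A n. {..<length (compose \<tau> 0 n [a])})"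
    using assms(1,2) unfolding recognizable_def tower_def by blast
  ultimately have "(case (a, k) of (a, k) \<Rightarrow> tower A \<tau> n a k) \<inter> (case (b, l) of (a, k) \<Rightarrow> tower A \<tau> n a k) = {}"
    using assms by (intro disjoint_family_onD) auto
  then show False using assms by auto
qed

lemma apply_point_shift_level:
  assumes "y \<in> level_shift A \<tau> n"
  shows "apply_point (compose \<tau> 0 n) (shift y) =
    (shift ^^ length (compose \<tau> 0 n [y 0])) (apply_point (compose \<tau> 0 n) y)"
  by (rule apply_point_shift[OF substitution_compose level_shift_range[OF assms]]) simp

text \<open>A level of a tower is the preimage of the level above it, since the shift is injective; all
  levels therefore have the measure of the base.\<close>

lemma measure_tower:
  assumes \<mu>: "\<mu> \<in> invariant_measures (A 0) (level_shift A \<tau> 0)"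
  shows "tower A \<tau> n a k \<in> sets \<mu>" "measure \<mu> (tower A \<tau> n a k) = measure \<mu> (base A \<tau> n a)"
proof -
  have sp: "space \<mu> = level_shift A \<tau> 0"
    and sets: "sets \<mu> = sets (borel_on (subshift_topology (A 0) (level_shift A \<tau> 0)))"
    and inv: "\<And>E. E \<in> sets \<mu> \<Longrightarrow> emeasure \<mu> (shift -` E \<inter> space \<mu>) = emeasure \<mu> E"
    using \<mu> by (auto simp: invariant_measures_def)
  show meas: "tower A \<tau> n a k \<in> sets \<mu>" for k
    unfolding sets subshift_topology_def
    using closedin_tower tower_subset
    by (intro closedin_sets_borel_on) (simp add: closedin_closed_subtopology closedin_level_shift)
  show "measure \<mu> (tower A \<tau> n a k) = measure \<mu> (base A \<tau> n a)"
  proof (induction k)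
    case 0
    show ?case by (simp add: tower_def)
  next
    case (Suc k)
    have "shift -` tower A \<tau> n a (Suc k) \<inter> space \<mu> = tower A \<tau> n a k"
    proof
      show "tower A \<tau> n a k \<subseteq> shift -` tower A \<tau> n a (Suc k) \<inter> space \<mu>"
        unfolding sp using shift_tower[of _ A \<tau> n a k] tower_subset[of n a k] by blast
      show "shift -` tower A \<tau> n a (Suc k) \<inter> space \<mu> \<subseteq> tower A \<tau> n a k"
      proof
        fix x assume "x \<in> shift -` tower A \<tau> n a (Suc k) \<inter> space \<mu>"
        then obtain z where "z \<in> base A \<tau> n a" "shift x = shift ((shift ^^ k) z)"
          by (auto simp: tower_def)
        then show "x \<in> tower A \<tau> n a k"
          using injD[OF inj_shift] by (auto simp: tower_def)
      qed
    qed
    then show ?case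
      using inv[OF meas[of "Suc k"]] Suc.IH by (simp add: measure_def)
  qed
qed

text \<open>Each time all letters appear, and there are at least two of them, all lengths double.\<close>

lemma primitive_growing:
  assumes "primitive A \<tau>"
  shows "\<exists>N. \<forall>n\<ge>N. \<forall>a\<in>A n. M \<le> length (compose \<tau> 0 n [a])"
proof (induction M)
  case 0
  show ?case by simp
next
  case (Suc M)
  then obtain N where N: "\<And>a. a \<in> A N \<Longrightarrow> M \<le> length (compose \<tau> 0 N [a])" by blast
  obtain m where m: "N < m" "\<And>a b. \<lbrakk>a \<in> A m; b \<in> A N\<rbrakk> \<Longrightarrow> b \<in> set (compose \<tau> N m [a])"
    using assms unfolding primitive_def by meson
  have "Suc M \<le> length (compose \<tau> 0 n [a])" if n: "n \<ge> m" and a: "a \<in> A n" for n a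
  proof -
    have sN: "substitution (A N) (A 0) (compose \<tau> 0 N)" by (rule substitution_compose) simp
    have sm: "substitution (A n) (A m) (compose \<tau> m n)" using n by (rule substitution_compose)
    have sNm: "substitution (A m) (A N) (compose \<tau> N m)" using m(1) by (intro substitution_compose) simp
    let ?u = "compose \<tau> m n [a]"
    let ?v = "compose \<tau> N m ?u"
    have u: "?u \<in> lists (A m)" "0 < length ?u"
      using a substitution_in_lists[OF sm, of "[a]"] substitution_nonempty[OF sm] by simp_all
    then obtain b where b: "b \<in> set ?u" "b \<in> A m" by (metis in_listsD length_greater_0_conv list.set_sel(1))
    have "sublist (compose \<tau> N m [b]) ?v"
      using b u by (intro substitution_sublist[OF sNm] sublist_singleton)
    then have "A N \<subseteq> set ?v"
      using m(2)[OF b(2)] set_mono_sublist by blast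
    then have "2 \<le> length ?v"
      using two_letters[of N] card_mono[of "set ?v" "A N"] card_length[of ?v] by simp
    have v: "?v \<in> lists (A N)" using substitution_in_lists[OF sNm u(1)] .
    \<comment> \<open>Lengths are positive, which lets the doubling start from \<open>M = 0\<close>.\<close>
    define K where "K = max M 1"
    have "K \<le> length (compose \<tau> 0 N [c])" if "c \<in> A N" for c
      using N[OF that] substitution_nonempty[OF sN that] unfolding K_def by linarith
    then have "K * length ?v \<le> length (compose \<tau> 0 N ?v)"
      by (rule length_substitution_bounds(1)[OF sN v])
    moreover have "K * 2 \<le> K * length ?v"
      using \<open>2 \<le> length ?v\<close> by (rule mult_le_mono2)
    moreover have "length (compose \<tau> 0 n [a]) = length (compose \<tau> 0 N ?v)"
      using m(1) n compose_trans[of 0 N n \<tau>] compose_trans[of N m n \<tau>] by simp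
    moreover have "Suc M \<le> K * 2" by (simp add: K_def max_def)
    ultimately show ?thesis by linarith
  qed
  then show ?case by blast
qed

end

section \<open>Eigenvalues as characters\<close>

lemma cis_2pi_eq_1_imp_Ints:
  assumes "cis (2 * pi * r) = 1"
  shows "r \<in> \<int>"
proof -
  have "cos (2 * pi * r) = 1" using assms by (simp add: complex_eq_iff)
  then obtain n :: int where "2 * pi * r = of_int n * 2 * pi"
    using cos_one_2pi_int by blast
  then have "r = of_int n" by simp
  then show ?thesis by simp
qed

lemma int_cong_iff: "y \<in> int_cong `` {x} \<longleftrightarrow> y - x \<in> \<int>"
  by (simp add: int_cong_def)

text \<open>The circle embeds in \<open>\<complex>\<close>, which turns an eigenfunction into a continuous function of
  modulus \<open>1\<close> that the shift multiplies by a constant.\<close>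

lemma eigenvalue_character:
  assumes X: "closedin (full_shift A) X" and \<alpha>: "eigenvalue A X \<alpha>"
  obtains E :: "(int \<Rightarrow> 'a) \<Rightarrow> complex" where
    "continuous_map (subshift_topology A X) euclidean E"
    "\<And>x. x \<in> X \<Longrightarrow> norm (E x) = 1"
    "\<And>x. x \<in> X \<Longrightarrow> E (shift x) = cis (2 * pi * \<alpha>) * E x"
proof -
  obtain g where g: "continuous_map (subshift_topology A X) circle_topology g"
      and eq: "\<And>x. x \<in> X \<Longrightarrow> g (shift x) = (\<lambda>y. y + \<alpha>) ` g x"
    using \<alpha> by (auto simp: eigenvalue_def)
  define \<phi> where "\<phi> c = cis (2 * pi * (SOME r. r \<in> c))" for c :: "real set"
  have \<phi>: "\<phi> (int_cong `` {r}) = cis (2 * pi * r)" for r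
  proof -
    define s where "s = (SOME s. s \<in> int_cong `` {r})"
    have "s \<in> int_cong `` {r}"
      unfolding s_def by (rule someI[of _ r]) (simp add: int_cong_def)
    then have "cis (2 * pi * (s - r)) = 1"
      by (intro cis_multiple_2pi) (simp only: int_cong_iff)
    then have "cis (2 * pi * r) * cis (2 * pi * (s - r)) = cis (2 * pi * r)" by simp
    then have "cis (2 * pi * s) = cis (2 * pi * r)" by (simp add: cis_mult algebra_simps)
    then show ?thesis by (simp only: \<phi>_def s_def)
  qed
  have "continuous_map euclidean euclidean (\<phi> \<circ> (\<lambda>x. int_cong `` {x}))"
    by (auto simp: o_def \<phi> cis_conv_exp intro!: continuous_intros)
  then have "continuous_map circle_topology euclidean \<phi>"
    by (rule continuous_compose_quotient_map[OF quotient_map_circle])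
  then have cont: "continuous_map (subshift_topology A X) euclidean (\<phi> \<circ> g)"
    by (rule continuous_map_compose[OF g])
  have "topspace circle_topology = UNIV // int_cong"
    using quotient_imp_surjective_map[OF quotient_map_circle] by (auto simp: quotient_def)
  moreover have "topspace (subshift_topology A X) = X"
    using closedin_subset[OF X] by (auto simp: subshift_topology_def)
  ultimately have "g x \<in> UNIV // int_cong" if "x \<in> X" for x
    using continuous_map_funspace[OF g] that by auto
  then have rep: "\<exists>r. g x = int_cong `` {r}" if "x \<in> X" for x
    using that by (meson quotientE)
  have "norm ((\<phi> \<circ> g) x) = 1" for x by (simp add: \<phi>_def)
  moreover have "(\<phi> \<circ> g) (shift x) = cis (2 * pi * \<alpha>) * (\<phi> \<circ> g) x" if "x \<in> X" for x
  proof -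
    obtain r where r: "g x = int_cong `` {r}" using rep[OF \<open>x \<in> X\<close>] by blast
    have "(\<lambda>y. y + \<alpha>) ` (int_cong `` {r}) = int_cong `` {r + \<alpha>}"
    proof (intro set_eqI iffI)
      fix y assume "y \<in> int_cong `` {r + \<alpha>}"
      then have "y - \<alpha> \<in> int_cong `` {r}" by (simp add: int_cong_def algebra_simps)
      then show "y \<in> (\<lambda>y. y + \<alpha>) ` (int_cong `` {r})" by (rule rev_image_eqI) simp
    qed (auto simp: int_cong_def)
    then have "g (shift x) = int_cong `` {r + \<alpha>}" using eq[OF that] r by simp
    then show ?thesis by (simp add: r \<phi> cis_mult algebra_simps)
  qed
  ultimately show thesis using that cont by blast
qed

lemma character_funpow:
  assumes "\<And>x. x \<in> X \<Longrightarrow> E (shift x) = cis (2 * pi * \<alpha>) * E x" "\<And>x. x \<in> X \<Longrightarrow> shift x \<in> X" "x \<in> X"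
  shows "E ((shift ^^ k) x) = cis (2 * pi * (real k * \<alpha>)) * E x"
proof (induction k)
  case (Suc k)
  have "(shift ^^ k) x \<in> X" using assms(2,3) by (induction k) auto
  then show ?case
    using assms(1) Suc by (simp add: cis_mult algebra_simps)
qed simp

text \<open>Uniform continuity bounds the dependence on a two-sided window; after shifting by half
  its length, which only rotates both values by the same angle, the window is one-sided.\<close>

lemma character_one_sided:
  assumes A: "finite A" and X: "closedin (full_shift A) X"
    and E: "continuous_map (subshift_topology A X) euclidean E"
    and eq: "\<And>x. x \<in> X \<Longrightarrow> E (shift x) = cis (2 * pi * \<alpha>) * E x"
    and inv: "\<And>x. x \<in> X \<Longrightarrow> shift x \<in> X" and "\<epsilon> > 0"
  obtains M where
    "\<And>x y. \<lbrakk>x \<in> X; y \<in> X; factor x 0 M = factor y 0 M\<rbrakk> \<Longrightarrow> dist (E x) (E y) < \<epsilon>"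
proof -
  obtain N where N: "\<And>x y. \<lbrakk>x \<in> X; y \<in> X; \<And>i. \<bar>i\<bar> \<le> int N \<Longrightarrow> x i = y i\<rbrakk> \<Longrightarrow> dist (E x) (E y) < \<epsilon>"
    using uniformly_continuous_window[OF A X E \<open>\<epsilon> > 0\<close>] by blast
  have inv_pow: "(shift ^^ N) x \<in> X" if "x \<in> X" for x
    using inv that by (induction N) auto
  show thesis
  proof
    fix x y assume xy: "x \<in> X" "y \<in> X" and f: "factor x 0 (2 * N + 1) = factor y 0 (2 * N + 1)"
    have "dist (E ((shift ^^ N) x)) (E ((shift ^^ N) y)) < \<epsilon>"
    proof (rule N)
      fix i :: int assume "\<bar>i\<bar> \<le> int N"
      then have k: "nat (i + int N) < 2 * N + 1" "i + int N = int (nat (i + int N))" by auto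
      then have "x (i + int N) = y (i + int N)"
        using arg_cong[OF f, of "\<lambda>w. w ! nat (i + int N)"] by simp
      then show "(shift ^^ N) x i = (shift ^^ N) y i" by (simp add: shift_funpow)
    qed (use xy inv_pow in auto)
    moreover have "dist (E ((shift ^^ N) x)) (E ((shift ^^ N) y)) = dist (E x) (E y)"
      using character_funpow[of X E \<alpha> _ N, OF eq inv] xy
      by (simp add: dist_norm norm_mult flip: right_diff_distrib)
    ultimately show "dist (E x) (E y) < \<epsilon>" by simp
  qed
qed

text \<open>For \<open>Re z > 0\<close> this is \<open>Arg z / (2 * pi)\<close>.  The formula with \<open>arctan\<close> is measurable and
  bounded by \<open>1 / 4\<close> on the whole plane, which keeps the lift below free of case distinctions.\<close>

definition small_angle :: "complex \<Rightarrow> real" where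
  "small_angle z = arctan (Im z / Re z) / (2 * pi)"

lemma small_angle_bound: "\<bar>small_angle z\<bar> < 1 / 4"
proof -
  have "\<bar>arctan (Im z / Re z)\<bar> < pi / 2"
    using arctan_lbound[of "Im z / Re z"] arctan_ubound[of "Im z / Re z"] by linarith
  then show ?thesis
    by (simp add: small_angle_def abs_divide divide_less_eq)
qed

lemma cis_small_angle:
  assumes "norm z = 1" "dist z 1 < 1"
  shows "cis (2 * pi * small_angle z) = z"
proof -
  have "\<bar>Re (z - 1)\<bar> < 1"
    using assms(2) abs_Re_le_cmod[of "z - 1"] by (simp add: dist_norm)
  then have "Re z > 0" by simp
  then have "2 * pi * small_angle z = Arg z"
    by (simp add: small_angle_def arg_conv_arctan)
  moreover have "z \<noteq> 0" using assms(1) by auto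
  ultimately show ?thesis
    using assms(1) by (simp add: cis_Arg sgn_div_norm)
qed

lemma borel_measurable_small_angle [measurable]: "small_angle \<in> borel_measurable borel"
  unfolding small_angle_def by measurable

section \<open>Integrating a real lift of the eigenfunction\<close>

context directive
begin

text \<open>The eigenfunction is lifted to a bounded measurable \<open>G\<close> with \<open>cis (2 * pi * G x) = E x\<close>.
  Since \<open>\<mu>\<close> is invariant, \<open>\<alpha>\<close> is the integral of the integer-valued function
  \<open>F x = G x + \<alpha> - G (shift x)\<close>, and the lift has to be chosen so that \<open>F\<close> is constant on the
  levels of the towers.  Along a tower \<open>G\<close> simply increases by \<open>\<alpha>\<close>, so \<open>F\<close> vanishes there.  On
  the top of the tower over \<open>a\<close> the value of \<open>F\<close> involves the angle chosen over the next letter;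
  the hypothesis \<open>next_class\<close> says that the class of that letter, and with it the angle, is
  determined by \<open>a\<close>, while \<open>class_close\<close> makes one angle per class a good enough choice.  The
  bound \<open>1\<close> on the distance corresponds to an angle below a quarter turn; two quarter turns
  leave an uncertainty of less than \<open>1 / 2\<close> on each side, which fixes an integer.\<close>

theorem integral_representation:
  fixes E :: "(int \<Rightarrow> 'a) \<Rightarrow> complex" and q :: "'a \<Rightarrow> 'c" and n :: nat
  defines "\<pi> \<equiv> apply_point (compose \<tau> 0 n)"
  assumes rec: "recognizable A \<tau>" and n: "1 \<le> n"
    and cont: "continuous_map (subshift_topology (A 0) (level_shift A \<tau> 0)) euclidean E"
    and norm: "\<And>x. x \<in> level_shift A \<tau> 0 \<Longrightarrow> norm (E x) = 1"
    and eq: "\<And>x. x \<in> level_shift A \<tau> 0 \<Longrightarrow> E (shift x) = cis (2 * pi * \<alpha>) * E x"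
    and next_class: "\<And>y z. \<lbrakk>y \<in> level_shift A \<tau> n; z \<in> level_shift A \<tau> n; y 0 = z 0\<rbrakk> \<Longrightarrow> q (y 1) = q (z 1)"
    and class_close: "\<And>y z. \<lbrakk>y \<in> level_shift A \<tau> n; z \<in> level_shift A \<tau> n; q (y 0) = q (z 0)\<rbrakk> \<Longrightarrow> dist (E (\<pi> y)) (E (\<pi> z)) < 1"
  shows "\<exists>w :: 'a \<Rightarrow> int. \<forall>\<mu>\<in>invariant_measures (A 0) (level_shift A \<tau> 0).
       \<alpha> = (\<Sum>a\<in>A n. of_int (w a) * measure \<mu> (base A \<tau> n a))"
proof -
  let ?X = "level_shift A \<tau> 0"
  define h where "h a = length (compose \<tau> 0 n [a])" for a
  have h_pos: "0 < h a" if "a \<in> A n" for a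
    unfolding h_def using that by (rule substitution_nonempty[OF substitution_compose, rotated]) simp
  define T where "T = tower A \<tau> n"
  have T_unique: "a = b \<and> k = l" if "a \<in> A n" "k < h a" "x \<in> T a k" "b \<in> A n" "l < h b" "x \<in> T b l" for a b k l x
    using tower_unique[OF rec n] that unfolding h_def T_def by blast
  have TX: "T a k \<subseteq> ?X" for a k unfolding T_def by (rule tower_subset)
  have E_pow: "E ((shift ^^ k) x) = cis (2 * pi * (real k * \<alpha>)) * E x" if "x \<in> ?X" for k x
    using eq shift_level_shift that by (rule character_funpow)
  have \<pi>X: "\<pi> y \<in> ?X" if "y \<in> level_shift A \<tau> n" for y
    unfolding \<pi>_def using that by (rule apply_point_level)

  \<comment> \<open>An angle for every class, taken at an arbitrary base point of the class.\<close>
  define c where "c b = (SOME r. \<exists>z\<in>level_shift A \<tau> n. q (z 0) = q b \<and> cis (2 * pi * r) = E (\<pi> z))" for b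
  have c_close: "dist (E (\<pi> y)) (cis (2 * pi * c (y 0))) < 1" if y: "y \<in> level_shift A \<tau> n" for y
  proof -
    have "E (\<pi> y) = cis (2 * pi * (Arg (E (\<pi> y)) / (2 * pi)))"
      using norm[OF \<pi>X[OF y]] rcis_cmod_Arg[of "E (\<pi> y)"] by (simp add: rcis_def)
    then have "\<exists>r. \<exists>z\<in>level_shift A \<tau> n. q (z 0) = q (y 0) \<and> cis (2 * pi * r) = E (\<pi> z)"
      using y by metis
    then have "\<exists>z\<in>level_shift A \<tau> n. q (z 0) = q (y 0) \<and> cis (2 * pi * c (y 0)) = E (\<pi> z)"
      unfolding c_def by (rule someI_ex)
    then show ?thesis using class_close[OF y] by metis
  qed
  have c_next: "c (y 1) = c (z 1)" if "y \<in> level_shift A \<tau> n" "z \<in> level_shift A \<tau> n" "y 0 = z 0" for y z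
    unfolding c_def next_class[OF that] ..

  \<comment> \<open>The real lift \<open>G\<close> of \<open>E\<close>: on level \<open>k\<close> of the tower over \<open>a\<close>, the branch close to
    \<open>c a + k \<alpha>\<close>.\<close>
  define v where "v a k x = c a + real k * \<alpha> + small_angle (E x * cis (- (2 * pi * (c a + real k * \<alpha>))))" for a k x
  define G where "G x = (\<Sum>p\<in>(SIGMA a:A n. {..<h a}). indicator (T (fst p) (snd p)) x * v (fst p) (snd p) x)" for x
  have fin: "finite (SIGMA a:A n. {..<h a})" using finite_alphabet by auto
  have G: "G x = v a k x" if "a \<in> A n" "k < h a" "x \<in> T a k" for a k x
  proof -
    have "G x = (\<Sum>p\<in>{(a, k)}. indicator (T (fst p) (snd p)) x * v (fst p) (snd p) x)"
      unfolding G_def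
    proof (rule sum.mono_neutral_right[OF fin])
      show "{(a, k)} \<subseteq> (SIGMA a:A n. {..<h a})" using that by auto
      show "\<forall>p\<in>(SIGMA a:A n. {..<h a}) - {(a, k)}. indicator (T (fst p) (snd p)) x * v (fst p) (snd p) x = 0"
        using T_unique[OF that] by (auto simp: indicator_def)
    qed
    then show ?thesis using that by simp
  qed
  have v_bound: "\<bar>v a k x - (c a + real k * \<alpha>)\<bar> < 1 / 4" for a k x
    using small_angle_bound by (simp add: v_def)
  have v_lift: "cis (2 * pi * v a k x) = E x" if "a \<in> A n" "x \<in> T a k" for a k x
  proof -
    obtain y where y: "y \<in> level_shift A \<tau> n" "y 0 = a" "x = (shift ^^ k) (\<pi> y)"
      using \<open>x \<in> T a k\<close> unfolding T_def \<pi>_def by (rule tower_cases)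
    let ?\<theta> = "2 * pi * (c a + real k * \<alpha>)"
    have "E x * cis (- ?\<theta>) = E (\<pi> y) * cis (- (2 * pi * c a))"
      using E_pow[OF \<pi>X[OF y(1)], of k] y(3) by (simp add: cis_mult algebra_simps)
    also have "dist \<dots> 1 = dist (E (\<pi> y)) (cis (2 * pi * c a))"
    proof -
      have "E (\<pi> y) * cis (- (2 * pi * c a)) - 1 = (E (\<pi> y) - cis (2 * pi * c a)) * cis (- (2 * pi * c a))"
        by (simp add: left_diff_distrib cis_mult)
      then show ?thesis by (simp add: dist_norm norm_mult)
    qed
    finally have "dist (E x * cis (- ?\<theta>)) 1 < 1" using c_close[OF y(1)] y(2) by simp
    moreover have "norm (E x * cis (- ?\<theta>)) = 1"
      using norm that(2) TX by (auto simp: norm_mult)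
    ultimately have "cis (2 * pi * small_angle (E x * cis (- ?\<theta>))) = E x * cis (- ?\<theta>)"
      by (rule cis_small_angle[rotated])
    then have "cis ?\<theta> * cis (2 * pi * small_angle (E x * cis (- ?\<theta>))) = cis ?\<theta> * (E x * cis (- ?\<theta>))"
      by simp
    then show ?thesis by (simp add: v_def cis_mult algebra_simps)
  qed

  define F where "F x = G x + \<alpha> - G (shift x)" for x
  \<comment> \<open>Below the top of a tower the branch moves along with the rotation.\<close>
  have F_inner: "F x = 0" if a: "a \<in> A n" "Suc k < h a" "x \<in> T a k" for a k x
  proof -
    have "shift x \<in> T a (Suc k)" using a(3) unfolding T_def by (rule shift_tower)
    then have "G (shift x) = v a (Suc k) (shift x)" using G a by simp
    also have "\<dots> = v a k x + \<alpha>"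
    proof -
      have "E (shift x) * cis (- (2 * pi * (c a + real (Suc k) * \<alpha>))) = E x * cis (- (2 * pi * (c a + real k * \<alpha>)))"
        using eq[of x] subsetD[OF TX a(3)] by (simp add: cis_mult algebra_simps)
      then show ?thesis by (simp add: v_def algebra_simps)
    qed
    finally show ?thesis using G[of a k x] a by (simp add: F_def)
  qed
  \<comment> \<open>At the top, \<open>F\<close> is an integer within \<open>1/2\<close> of a number that depends on \<open>a\<close> only.\<close>
  have F_top: "F x \<in> \<int> \<and> \<bar>F x - (c a + real (h a) * \<alpha> - c (y 1))\<bar> < 1 / 2"
    if y: "y \<in> level_shift A \<tau> n" "y 0 = a" and x: "x = (shift ^^ (h a - 1)) (\<pi> y)" for a x y
  proof -
    have a: "a \<in> A n" using y level_shift_letters by metis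
    have top: "h a - 1 < h a" using h_pos[OF a] by simp
    have xT: "x \<in> T a (h a - 1)"
      unfolding x T_def \<pi>_def using tower_intro[OF y(1)] y(2) by metis
    have b: "y 1 \<in> A n" using y(1) level_shift_letters by metis
    have "shift x = (shift ^^ h a) (\<pi> y)"
      using h_pos[OF a] unfolding x by (metis Suc_pred' funpow.simps(2) comp_apply)
    also have "\<dots> = \<pi> (shift y)"
      using apply_point_shift_level[OF y(1)] y(2) by (simp add: \<pi>_def h_def)
    also have "\<dots> \<in> T (y 1) 0"
      using tower_intro[OF shift_level_shift[OF y(1)], of 0] by (simp add: T_def \<pi>_def shift_def)
    finally have SxT: "shift x \<in> T (y 1) 0" .
    have Gx: "G x = v a (h a - 1) x" and GSx: "G (shift x) = v (y 1) 0 (shift x)"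
      using G[OF a top xT] G[OF b h_pos[OF b] SxT] by simp_all
    have "cis (2 * pi * F x) * E (shift x) = cis (2 * pi * \<alpha>) * E x"
      using v_lift[OF a xT] v_lift[OF b SxT]
      by (simp add: F_def Gx GSx cis_mult algebra_simps flip: v_lift[OF a xT] v_lift[OF b SxT])
    also have "\<dots> = E (shift x)" using eq[OF subsetD[OF TX xT]] by simp
    finally have "cis (2 * pi * F x) = 1"
      using norm[of "shift x"] SxT TX by (metis mult_cancel_right2 norm_zero subsetD zero_neq_one)
    then have F_int: "F x \<in> \<int>" by (rule cis_2pi_eq_1_imp_Ints)
    have "real (h a - 1) * \<alpha> + \<alpha> = real (h a) * \<alpha>"
      using h_pos[OF a] by (simp add: of_nat_diff algebra_simps)
    moreover have "\<bar>v (y 1) 0 (shift x) - c (y 1)\<bar> < 1 / 4"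
      using v_bound[of "y 1" 0 "shift x"] by simp
    ultimately have "\<bar>F x - (c a + real (h a) * \<alpha> - c (y 1))\<bar> < 1 / 2"
      using v_bound[of a "h a - 1" x] unfolding F_def Gx GSx by linarith
    with F_int show ?thesis ..
  qed
  have "\<exists>w::int. \<forall>x\<in>T a (h a - 1). F x = of_int w" if "a \<in> A n" for a
  proof (cases "T a (h a - 1) = {}")
    case False
    then obtain x where x: "x \<in> T a (h a - 1)" by blast
    obtain y where y: "y \<in> level_shift A \<tau> n" "y 0 = a" "x = (shift ^^ (h a - 1)) (\<pi> y)"
      using x unfolding T_def \<pi>_def by (rule tower_cases)
    obtain w :: int where w: "F x = of_int w" using F_top[OF y] by (auto elim: Ints_cases)
    have "F x' = of_int w" if "x' \<in> T a (h a - 1)" for x'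
    proof -
      obtain z where z: "z \<in> level_shift A \<tau> n" "z 0 = a" "x' = (shift ^^ (h a - 1)) (\<pi> z)"
        using \<open>x' \<in> T a (h a - 1)\<close> unfolding T_def \<pi>_def by (rule tower_cases)
      obtain w' :: int where w': "F x' = of_int w'" using F_top[OF z] by (auto elim: Ints_cases)
      have "c (y 1) = c (z 1)" using y z by (intro c_next) simp_all
      then have "\<bar>F x - F x'\<bar> < 1" using F_top[OF y, THEN conjunct2] F_top[OF z, THEN conjunct2] by linarith
      then have "\<bar>w - w'\<bar> < 1" unfolding w w' by linarith
      then show ?thesis using w' by simp
    qed
    then show ?thesis by blast
  qed simp
  then obtain w :: "'a \<Rightarrow> int" where w: "\<And>a x. \<lbrakk>a \<in> A n; x \<in> T a (h a - 1)\<rbrakk> \<Longrightarrow> F x = of_int (w a)"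
    by metis
  have F_sum: "F x = (\<Sum>a\<in>A n. of_int (w a) * indicator (T a (h a - 1)) x)" if "x \<in> ?X" for x
  proof -
    obtain a k where ak: "a \<in> A n" "k < h a" "x \<in> T a k"
      using tower_cover[OF \<open>x \<in> ?X\<close>] unfolding h_def T_def by blast
    have "(\<Sum>b\<in>A n. of_int (w b) * indicator (T b (h b - 1)) x) = (\<Sum>b\<in>{a}. of_int (w b) * indicator (T b (h b - 1)) x :: real)"
    proof (rule sum.mono_neutral_right[OF finite_alphabet])
      show "\<forall>b\<in>A n - {a}. of_int (w b) * indicator (T b (h b - 1)) x = (0::real)"
      proof
        fix b assume b: "b \<in> A n - {a}"
        then have "x \<notin> T b (h b - 1)"
          using T_unique[OF ak, of b "h b - 1"] h_pos[of b] by auto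
        then show "of_int (w b) * indicator (T b (h b - 1)) x = (0::real)" by simp
      qed
    qed (use ak in auto)
    also have "\<dots> = F x"
    proof (cases "Suc k < h a")
      case True
      then have "x \<notin> T a (h a - 1)" using T_unique[OF ak, of a "h a - 1"] ak(1) by auto
      then show ?thesis using F_inner[OF ak(1) True ak(3)] by simp
    next
      case False
      then have "k = h a - 1" using ak(2) by simp
      then show ?thesis using w[of a x] ak by simp
    qed
    finally show ?thesis by simp
  qed

  have "\<alpha> = (\<Sum>a\<in>A n. of_int (w a) * measure \<mu> (base A \<tau> n a))"
    if \<mu>: "\<mu> \<in> invariant_measures (A 0) ?X" for \<mu>
  proof -
    interpret prob_space \<mu> using \<mu> by (simp add: invariant_measures_def)
    have sp: "space \<mu> = ?X"
      and sets: "sets \<mu> = sets (borel_on (subshift_topology (A 0) ?X))"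
      and inv: "\<And>B. B \<in> sets \<mu> \<Longrightarrow> emeasure \<mu> (shift -` B \<inter> space \<mu>) = emeasure \<mu> B"
      using \<mu> by (auto simp: invariant_measures_def)
    have T_meas [measurable]: "T a k \<in> sets \<mu>" for a k
      unfolding T_def by (rule measure_tower(1)[OF \<mu>])
    have E_meas [measurable]: "E \<in> borel_measurable \<mu>"
      by (rule continuous_imp_measurable_borel_on[OF cont sets])
    have "continuous_map (subshift_topology (A 0) ?X) (subshift_topology (A 0) ?X) shift"
      unfolding subshift_topology_def
      using shift_level_shift
      by (intro continuous_map_into_subtopology continuous_map_from_subtopology continuous_map_shift) auto
    then have shift_meas [measurable]: "shift \<in> measurable \<mu> \<mu>"
      using sets by (rule continuous_imp_measurable_self)
    have distr: "distr \<mu> \<mu> shift = \<mu>"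
    proof (rule measure_eqI)
      fix B assume "B \<in> sets (distr \<mu> \<mu> shift)"
      then show "emeasure (distr \<mu> \<mu> shift) B = emeasure \<mu> B"
        using inv by (simp add: emeasure_distr shift_meas)
    qed simp
    have G_meas [measurable]: "G \<in> borel_measurable \<mu>"
      unfolding G_def v_def by measurable
    have "integrable \<mu> G"
    proof (rule integrable_const_bound)
      show "AE x in \<mu>. norm (G x) \<le> (\<Sum>p\<in>(SIGMA a:A n. {..<h a}). \<bar>c (fst p) + real (snd p) * \<alpha>\<bar> + 1 / 4)"
      proof (rule AE_I2)
        fix x
        have "norm (G x) \<le> (\<Sum>p\<in>(SIGMA a:A n. {..<h a}). norm (indicator (T (fst p) (snd p)) x * v (fst p) (snd p) x))"
          unfolding G_def by (rule norm_sum)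
        also have "\<dots> \<le> (\<Sum>p\<in>(SIGMA a:A n. {..<h a}). \<bar>c (fst p) + real (snd p) * \<alpha>\<bar> + 1 / 4)"
        proof (rule sum_mono)
          fix p
          have "\<bar>v (fst p) (snd p) x\<bar> \<le> \<bar>c (fst p) + real (snd p) * \<alpha>\<bar> + 1 / 4"
            using v_bound[of "fst p" "snd p" x] by linarith
          then show "norm (indicator (T (fst p) (snd p)) x * v (fst p) (snd p) x) \<le> \<bar>c (fst p) + real (snd p) * \<alpha>\<bar> + 1 / 4"
            by (auto simp: indicator_def)
        qed
        finally show "norm (G x) \<le> (\<Sum>p\<in>(SIGMA a:A n. {..<h a}). \<bar>c (fst p) + real (snd p) * \<alpha>\<bar> + 1 / 4)" .
      qed
    qed (rule G_meas)
    then have int_GS: "integrable \<mu> (\<lambda>x. G (shift x))"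
      using integrable_distr[OF shift_meas, of G] distr by simp
    have "(\<integral>x. G (shift x) \<partial>\<mu>) = (\<integral>x. G x \<partial>\<mu>)"
      using integral_distr[OF shift_meas G_meas] distr by simp
    then have "\<alpha> = (\<integral>x. F x \<partial>\<mu>)"
      unfolding F_def using \<open>integrable \<mu> G\<close> int_GS by (simp add: prob_space)
    also have "\<dots> = (\<integral>x. (\<Sum>a\<in>A n. of_int (w a) * indicator (T a (h a - 1)) x) \<partial>\<mu>)"
      using F_sum by (intro Bochner_Integration.integral_cong) (simp_all add: sp)
    also have "\<dots> = (\<Sum>a\<in>A n. of_int (w a) * measure \<mu> (T a (h a - 1)))"
      by (subst Bochner_Integration.integral_sum) (auto intro!: integrable_real_indicator simp: emeasure_eq_measure Int_absorb2 TX sp)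
    also have "\<dots> = (\<Sum>a\<in>A n. of_int (w a) * measure \<mu> (base A \<tau> n a))"
      unfolding T_def by (simp add: measure_tower(2)[OF \<mu>])
    finally show ?thesis .
  qed
  then show ?thesis by blast
qed

end

section \<open>Classes of letters\<close>

context directive
begin

lemma factor_prefix_image:
  assumes y: "y \<in> level_shift A \<tau> n" and p: "prefix p (compose \<tau> 0 n [y 0])" and M: "M \<le> length p"
  shows "factor (apply_point (compose \<tau> 0 n) y) 0 M = take M p"
proof -
  let ?x = "apply_point (compose \<tau> 0 n) y" and ?w = "compose \<tau> 0 n [y 0]"
  have w: "factor ?x 0 (length ?w) = ?w"
    by (rule factor_image_of_letter[OF substitution_compose level_shift_range[OF y]]) simp
  obtain s where s: "?w = p @ s" using p by (auto simp: prefix_def)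
  then have "length ?w = M + (length ?w - M)" using M by simp
  then have "factor ?x 0 M = take M (factor ?x 0 (length ?w))"
    by (metis factor_append length_factor append_eq_conv_conj)
  then show ?thesis using w s M by simp
qed

text \<open>In the decisive case the class of a letter \<open>b\<close> of level \<open>m + 1\<close> is the first letter of
  its image: it is the letter \<open>r a\<close> for every predecessor \<open>a\<close> of \<open>b\<close>, and the points over \<open>b\<close>
  begin with its long image.\<close>

lemma decisive_classes:
  fixes E :: "(int \<Rightarrow> 'a) \<Rightarrow> complex"
  assumes dec: "decisive A \<tau>"
    and one_sided: "\<And>x y. \<lbrakk>x \<in> level_shift A \<tau> 0; y \<in> level_shift A \<tau> 0; factor x 0 M = factor y 0 M\<rbrakk> \<Longrightarrow> dist (E x) (E y) < \<epsilon>"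
    and long: "\<And>a. a \<in> A m \<Longrightarrow> M \<le> length (compose \<tau> 0 m [a])"
    and y: "y \<in> level_shift A \<tau> (Suc m)" and z: "z \<in> level_shift A \<tau> (Suc m)"
  shows "y 0 = z 0 \<Longrightarrow> hd (\<tau> m [y 1]) = hd (\<tau> m [z 1])"
    and "hd (\<tau> m [y 0]) = hd (\<tau> m [z 0]) \<Longrightarrow>
      dist (E (apply_point (compose \<tau> 0 (Suc m)) y)) (E (apply_point (compose \<tau> 0 (Suc m)) z)) < \<epsilon>"
proof -
  obtain r where r: "\<And>a b. \<lbrakk>a \<in> A (Suc m); b \<in> A (Suc m); [a, b] \<in> language (level_shift A \<tau> (Suc m))\<rbrakk>
      \<Longrightarrow> prefix [r a] (\<tau> m [b])"
    using dec unfolding decisive_def by meson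
  have next_letter: "hd (\<tau> m [u 1]) = r (u 0)" if u: "u \<in> level_shift A \<tau> (Suc m)" for u
  proof -
    have "factor u 0 2 = [u 0, u 1]" by (simp add: factor_def numeral_2_eq_2)
    moreover have "factor u 0 2 \<in> language (level_shift A \<tau> (Suc m))"
      using u unfolding language_def by blast
    ultimately have "[u 0, u 1] \<in> language (level_shift A \<tau> (Suc m))" by simp
    then have "prefix [r (u 0)] (\<tau> m [u 1])"
      using r level_shift_letters[OF u] by blast
    then show ?thesis by (auto simp: prefix_def)
  qed
  then show "y 0 = z 0 \<Longrightarrow> hd (\<tau> m [y 1]) = hd (\<tau> m [z 1])" using y z by simp
  have t: "substitution (A (Suc m)) (A m) (\<tau> m)"
    using directive by (simp add: directive_sequence_def)
  have T: "substitution (A m) (A 0) (compose \<tau> 0 m)"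
    by (rule substitution_compose) simp
  have pre: "prefix (compose \<tau> 0 m [hd (\<tau> m [b])]) (compose \<tau> 0 (Suc m) [b])" "hd (\<tau> m [b]) \<in> A m"
    if b: "b \<in> A (Suc m)" for b
  proof -
    obtain f v where fv: "\<tau> m [b] = f # v"
      using substitution_nonempty[OF t b] by (cases "\<tau> m [b]") auto
    then have mem: "f \<in> A m" "v \<in> lists (A m)"
      using substitution_in_lists[OF t, of "[b]"] b by auto
    then have "compose \<tau> 0 m (\<tau> m [b]) = compose \<tau> 0 m [f] @ compose \<tau> 0 m v"
      using substitution_append[OF T, of "[f]" v] fv by simp
    then show "prefix (compose \<tau> 0 m [hd (\<tau> m [b])]) (compose \<tau> 0 (Suc m) [b])"
      by (simp add: compose_Suc_right fv)
    show "hd (\<tau> m [b]) \<in> A m" using fv mem by simp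
  qed
  show "dist (E (apply_point (compose \<tau> 0 (Suc m)) y)) (E (apply_point (compose \<tau> 0 (Suc m)) z)) < \<epsilon>"
    if same: "hd (\<tau> m [y 0]) = hd (\<tau> m [z 0])"
  proof (rule one_sided)
    have y0: "y 0 \<in> A (Suc m)" and z0: "z 0 \<in> A (Suc m)"
      using level_shift_letters[OF y] level_shift_letters[OF z] by simp_all
    show "factor (apply_point (compose \<tau> 0 (Suc m)) y) 0 M = factor (apply_point (compose \<tau> 0 (Suc m)) z) 0 M"
      using factor_prefix_image[OF y pre(1)[OF y0] long[OF pre(2)[OF y0]]]
        factor_prefix_image[OF z pre(1)[OF z0] long[OF pre(2)[OF z0]]] same by simp
  qed (rule apply_point_level[OF y] apply_point_level[OF z])+
qed

text \<open>Letters that may follow one and the same letter.  The classes used when the number of letters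
  is bounded are those of the equivalence relation that this symmetric relation generates.\<close>

definition common_predecessor :: "nat \<Rightarrow> ('a \<times> 'a) set" where
  "common_predecessor n =
     {(y 1, z 1) | y z. y \<in> level_shift A \<tau> n \<and> z \<in> level_shift A \<tau> n \<and> y 0 = z 0}"

lemma common_predecessor_subset: "common_predecessor n \<subseteq> A n \<times> A n"
  by (auto simp: common_predecessor_def intro: level_shift_letters)

lemma finite_common_predecessor: "finite (common_predecessor n)"
  by (rule finite_subset[OF common_predecessor_subset]) (simp add: finite_alphabet)

lemma card_common_predecessor: "card (common_predecessor n) \<le> card (A n) * card (A n)"
  using card_mono[OF _ common_predecessor_subset[of n]] by (simp add: finite_alphabet card_cartesian_product)

text \<open>Points over the same letter have close values of \<open>E\<close>; moving both up by the height of
  that letter's tower, so have some points over any two letters with a common predecessor.  A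
  link of the chain thus costs \<open>2 * \<epsilon>\<close>: one \<open>\<epsilon>\<close> for the pair moved up the tower, one for
  exchanging two points over the same letter.\<close>

lemma chain_close:
  fixes E :: "(int \<Rightarrow> 'a) \<Rightarrow> complex"
  defines "\<pi> \<equiv> \<lambda>n. apply_point (compose \<tau> 0 n)"
  assumes one_sided: "\<And>x y. \<lbrakk>x \<in> level_shift A \<tau> 0; y \<in> level_shift A \<tau> 0; factor x 0 M = factor y 0 M\<rbrakk> \<Longrightarrow> dist (E x) (E y) < \<epsilon>"
    and eq: "\<And>x. x \<in> level_shift A \<tau> 0 \<Longrightarrow> E (shift x) = cis (2 * pi * \<alpha>) * E x"
    and long: "\<And>a. a \<in> A n \<Longrightarrow> M \<le> length (compose \<tau> 0 n [a])"
    and z: "z \<in> level_shift A \<tau> n" "z' \<in> level_shift A \<tau> n"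
    and chain: "(z 0, z' 0) \<in> common_predecessor n ^^ i"
  shows "dist (E (\<pi> n z)) (E (\<pi> n z')) < real (2 * i + 1) * \<epsilon>"
proof -
  have same: "dist (E (\<pi> n u)) (E (\<pi> n u')) < \<epsilon>"
    if u: "u \<in> level_shift A \<tau> n" "u' \<in> level_shift A \<tau> n" "u 0 = u' 0" for u u'
  proof (rule one_sided)
    have "u 0 \<in> A n" by (rule level_shift_letters[OF u(1)])
    then show "factor (\<pi> n u) 0 M = factor (\<pi> n u') 0 M"
      using factor_prefix_image[OF u(1), of "compose \<tau> 0 n [u 0]" M] factor_prefix_image[OF u(2), of "compose \<tau> 0 n [u' 0]" M]
        long u(3) by (simp add: \<pi>_def)
    show "\<pi> n u \<in> level_shift A \<tau> 0" "\<pi> n u' \<in> level_shift A \<tau> 0"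
      unfolding \<pi>_def using apply_point_level[OF u(1)] apply_point_level[OF u(2)] by simp_all
  qed
  show ?thesis
    using z(2) chain
  proof (induction i arbitrary: z')
    case 0
    then show ?case using same[OF z(1)] by simp
  next
    case (Suc i)
    then obtain b where b: "(z 0, b) \<in> common_predecessor n ^^ i" "(b, z' 0) \<in> common_predecessor n" by auto
    obtain y y' where y: "y \<in> level_shift A \<tau> n" "y' \<in> level_shift A \<tau> n" "y 0 = y' 0" "b = y 1" "z' 0 = y' 1"
      using b(2) unfolding common_predecessor_def by auto
    have Sy: "shift y \<in> level_shift A \<tau> n" "shift y' \<in> level_shift A \<tau> n" "shift y 0 = b" "shift y' 0 = z' 0"
      using y shift_level_shift by (auto simp: shift_def)
    let ?k = "length (compose \<tau> 0 n [y 0])"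
    have rot: "E (\<pi> n (shift u)) = cis (2 * pi * (real ?k * \<alpha>)) * E (\<pi> n u)"
      if "u \<in> level_shift A \<tau> n" "u 0 = y 0" for u
      using character_funpow[of "level_shift A \<tau> 0" E \<alpha> "\<pi> n u" ?k, OF eq shift_level_shift]
        apply_point_level[OF that(1)] apply_point_shift_level[OF that(1)] that(2) by (simp add: \<pi>_def)
    have "dist (E (\<pi> n (shift y))) (E (\<pi> n (shift y'))) = dist (E (\<pi> n y)) (E (\<pi> n y'))"
      using rot[OF y(1)] rot[OF y(2)] y(3) by (simp add: dist_norm norm_mult flip: right_diff_distrib)
    also have "\<dots> < \<epsilon>" using same y by blast
    finally have "dist (E (\<pi> n (shift y))) (E (\<pi> n (shift y'))) < \<epsilon>" .
    moreover have "dist (E (\<pi> n z)) (E (\<pi> n (shift y))) < real (2 * i + 1) * \<epsilon>"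
      using Suc.IH[OF Sy(1)] b(1) Sy(3) by simp
    moreover have "dist (E (\<pi> n (shift y'))) (E (\<pi> n z')) < \<epsilon>"
      using same Sy(2,4) Suc.prems(1) by blast
    moreover have "dist (E (\<pi> n z)) (E (\<pi> n z')) \<le> dist (E (\<pi> n z)) (E (\<pi> n (shift y)))
        + dist (E (\<pi> n (shift y))) (E (\<pi> n (shift y'))) + dist (E (\<pi> n (shift y'))) (E (\<pi> n z'))"
      using dist_triangle[of "E (\<pi> n z)" "E (\<pi> n z')" "E (\<pi> n (shift y'))"]
        dist_triangle[of "E (\<pi> n z)" "E (\<pi> n (shift y'))" "E (\<pi> n (shift y))"] by linarith
    moreover have "real (2 * Suc i + 1) * \<epsilon> = real (2 * i + 1) * \<epsilon> + \<epsilon> + \<epsilon>"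
      by (simp add: algebra_simps)
    ultimately show ?case by linarith
  qed
qed

text \<open>A finite relation reaches every element of a class in at most as many steps as it has pairs,
  which bounds the chains by the square of the number of letters.\<close>

lemma common_predecessor_classes:
  fixes n
  defines "q \<equiv> \<lambda>b. (common_predecessor n)\<^sup>* `` {b}"
  assumes y: "y \<in> level_shift A \<tau> n" and z: "z \<in> level_shift A \<tau> n"
  shows "y 0 = z 0 \<Longrightarrow> q (y 1) = q (z 1)"
    and "q (y 0) = q (z 0) \<Longrightarrow> \<exists>i\<le>card (A n) * card (A n). (y 0, z 0) \<in> common_predecessor n ^^ i"
proof -
  assume "y 0 = z 0"
  then have "(y 1, z 1) \<in> common_predecessor n" "(z 1, y 1) \<in> common_predecessor n"
    using y z unfolding common_predecessor_def by force+
  then show "q (y 1) = q (z 1)"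
    unfolding q_def by (auto intro: converse_rtrancl_into_rtrancl)
next
  assume "q (y 0) = q (z 0)"
  then have "(y 0, z 0) \<in> (common_predecessor n)\<^sup>*" unfolding q_def by blast
  then show "\<exists>i\<le>card (A n) * card (A n). (y 0, z 0) \<in> common_predecessor n ^^ i"
    using card_common_predecessor[of n] unfolding rtrancl_finite_eq_relpow[OF finite_common_predecessor]
    by (auto intro: order.trans)
qed

end

theorem proposition5p5:
  fixes A :: "nat \<Rightarrow> 'a set" and \<tau> :: "nat \<Rightarrow> 'a list \<Rightarrow> 'a list" and X :: "(int \<Rightarrow> 'a) set"
  assumes "directive_sequence A \<tau>"
    and "primitive A \<tau>"
    and "recognizable A \<tau>"
    and "subshift (A 0) X"
    and "generates A \<tau> X"
    and "decisive A \<tau> \<or> bdd_above (range (\<lambda>n. card (A n)))"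
  shows "\<forall>\<alpha>. eigenvalue (A 0) X \<alpha> \<longrightarrow>
    (\<forall>\<^sub>F n in sequentially. \<exists>w :: 'a \<Rightarrow> int. \<forall>\<mu>\<in>invariant_measures (A 0) X.
       \<alpha> = (\<Sum>a\<in>A n. of_int (w a) * measure \<mu> (base A \<tau> n a)))"
proof (intro allI impI)
  fix \<alpha> assume \<alpha>: "eigenvalue (A 0) X \<alpha>"
  interpret directive A \<tau> by unfold_locales (rule assms(1))
  let ?X = "level_shift A \<tau> 0"
  have X: "X = ?X" using assms(5) by (simp add: generates_def)
  note closed = closedin_level_shift[of A 0 \<tau>]
  obtain E :: "(int \<Rightarrow> 'a) \<Rightarrow> complex" where
    cont: "continuous_map (subshift_topology (A 0) ?X) euclidean E"
    and norm: "\<And>x. x \<in> ?X \<Longrightarrow> norm (E x) = 1"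
    and eq: "\<And>x. x \<in> ?X \<Longrightarrow> E (shift x) = cis (2 * pi * \<alpha>) * E x"
    using eigenvalue_character[OF closed] \<alpha> unfolding X by blast
  note one_sided = character_one_sided[OF finite_alphabet closed cont eq shift_level_shift]
  note rep = integral_representation[OF assms(3) _ cont norm eq]
  show "\<forall>\<^sub>F n in sequentially. \<exists>w :: 'a \<Rightarrow> int. \<forall>\<mu>\<in>invariant_measures (A 0) X.
       \<alpha> = (\<Sum>a\<in>A n. of_int (w a) * measure \<mu> (base A \<tau> n a))"
    using assms(6)
  proof
    assume dec: "decisive A \<tau>"
    obtain M where M: "\<And>x y. \<lbrakk>x \<in> ?X; y \<in> ?X; factor x 0 M = factor y 0 M\<rbrakk> \<Longrightarrow> dist (E x) (E y) < 1"
      using one_sided[of 1] by auto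
    obtain N where N: "\<And>n a. \<lbrakk>N \<le> n; a \<in> A n\<rbrakk> \<Longrightarrow> M \<le> length (compose \<tau> 0 n [a])"
      using primitive_growing[OF assms(2), of M] by blast
    have "\<exists>w :: 'a \<Rightarrow> int. \<forall>\<mu>\<in>invariant_measures (A 0) X.
       \<alpha> = (\<Sum>a\<in>A n. of_int (w a) * measure \<mu> (base A \<tau> n a))" if "n \<ge> Suc N" for n
    proof -
      \<comment> \<open>First letters of images under \<open>\<tau> m\<close> live one level below \<open>n\<close>, where the blocks must
        already be long.\<close>
      obtain m where m: "n = Suc m" "N \<le> m" using \<open>n \<ge> Suc N\<close> by (cases n) auto
      show ?thesis
        unfolding X m(1)
      proof (rule rep[where q = "\<lambda>b. hd (\<tau> m [b])"])
        fix y z assume y: "y \<in> level_shift A \<tau> (Suc m)" and z: "z \<in> level_shift A \<tau> (Suc m)"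
        note classes = decisive_classes[OF dec M N[OF m(2)] y z]
        show "hd (\<tau> m [y 1]) = hd (\<tau> m [z 1])" if "y 0 = z 0"
          by (rule classes(1)) (assumption | rule that)+
        show "dist (E (apply_point (compose \<tau> 0 (Suc m)) y)) (E (apply_point (compose \<tau> 0 (Suc m)) z)) < 1"
          if "hd (\<tau> m [y 0]) = hd (\<tau> m [z 0])"
          by (rule classes(2)) (assumption | rule that)+
      qed simp
    qed
    then show ?thesis by (rule eventually_sequentiallyI)
  next
    assume "bdd_above (range (\<lambda>n. card (A n)))"
    then obtain d where d: "\<And>n. card (A n) \<le> d" by (auto simp: bdd_above_def)
    \<comment> \<open>Chains have at most \<open>d\<^sup>2\<close> links, the number of pairs of letters, so their total error
      stays below \<open>D * \<epsilon> = 1\<close>.\<close>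
    define D where "D = real (2 * (d * d) + 1)"
    have "D > 0" unfolding D_def of_nat_0_less_iff by simp
    define \<epsilon> where "\<epsilon> = 1 / D"
    have "\<epsilon> > 0" using \<open>D > 0\<close> by (simp add: \<epsilon>_def)
    then obtain M where M: "\<And>x y. \<lbrakk>x \<in> ?X; y \<in> ?X; factor x 0 M = factor y 0 M\<rbrakk> \<Longrightarrow> dist (E x) (E y) < \<epsilon>"
      using one_sided[of \<epsilon>] by auto
    obtain N where N: "\<And>n a. \<lbrakk>N \<le> n; a \<in> A n\<rbrakk> \<Longrightarrow> M \<le> length (compose \<tau> 0 n [a])"
      using primitive_growing[OF assms(2), of M] by blast
    have "\<exists>w :: 'a \<Rightarrow> int. \<forall>\<mu>\<in>invariant_measures (A 0) X.
       \<alpha> = (\<Sum>a\<in>A n. of_int (w a) * measure \<mu> (base A \<tau> n a))" if n: "n \<ge> Suc N" for n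
      unfolding X
    proof (rule rep[where q = "\<lambda>b. (common_predecessor n)\<^sup>* `` {b}"])
      show "1 \<le> n" using n by simp
      fix y z assume y: "y \<in> level_shift A \<tau> n" and z: "z \<in> level_shift A \<tau> n"
      show "(common_predecessor n)\<^sup>* `` {y 1} = (common_predecessor n)\<^sup>* `` {z 1}" if "y 0 = z 0"
        using common_predecessor_classes(1)[OF y z that] .
      assume "(common_predecessor n)\<^sup>* `` {y 0} = (common_predecessor n)\<^sup>* `` {z 0}"
      then obtain i where i: "i \<le> card (A n) * card (A n)" "(y 0, z 0) \<in> common_predecessor n ^^ i"
        using common_predecessor_classes(2)[OF y z] by blast
      have "i \<le> d * d" using i(1) d[of n] mult_le_mono[of "card (A n)" d "card (A n)" d] by linarith
      have "dist (E (apply_point (compose \<tau> 0 n) y)) (E (apply_point (compose \<tau> 0 n) z)) < real (2 * i + 1) * \<epsilon>"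
      proof (rule chain_close[OF _ _ _ y z i(2)])
        show "M \<le> length (compose \<tau> 0 n [a])" if "a \<in> A n" for a
          using N n that by simp
      qed (rule M eq, assumption+)+
      also have "\<dots> \<le> D * \<epsilon>"
        unfolding D_def using \<open>i \<le> d * d\<close> \<open>\<epsilon> > 0\<close> by (intro mult_right_mono of_nat_mono) simp_all
      also have "\<dots> = 1" using \<open>D > 0\<close> by (simp add: \<epsilon>_def)
      finally show "dist (E (apply_point (compose \<tau> 0 n) y)) (E (apply_point (compose \<tau> 0 n) z)) < 1" .
    qed
    then show ?thesis by (rule eventually_sequentiallyI)
  qed
qed

end
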